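(* The complete Turán hierarchy for the pair $\{M_2,C_3\}$ is as follows. 1. For $n\le 5$: $\mathrm{ex}^{(1)}(n;\{M_2,C_3\})=\binom n3$, $\mathrm{Ex}^{(1)}(n;\{M_2,C_3\})=\{K_n\}$, and $\mathrm{ex}^{(s)}(n;\{M_2,C_3\})$ does not exist for $s\ge2$. 2. For $n=6$: $\mathrm{ex}^{(1)}(6;\{M_2,C_3\})=10$, $\mathrm{Ex}^{(1)}(6;\{M_2,C_3\})=\{S_6,K_5\cup K_1\}$, $\mathrm{ex}^{(2)}(6;\{M_2,C_3\})=6$, $\mathrm{Ex}^{(2)}(6;\{M_2,C_3\})=\{H_0(6)\}$, and $\mathrm{ex}^{(s)}(6;\{M_2,C_3\})$ does not exist for $s\ge3$. 3. For $n\ge7$: $\mathrm{ex}^{(1)}(n;\{M_2,C_3\})=\binom{n-1}{2}$ and $\mathrm{Ex}^{(1)}(n;\{M_2,C_3\})=\{S_n\}$. 4. For $n=10$: $\mathrm{Ex}^{(2)}(10;\{M_2,C_3\})=\{K_5\cup 5K_1,H_0(10)\}$ and $\mathrm{ex}^{(s)}(10;\{M_2,C_3\})$ does not exist for $s\ge3$. 5. For $n\ge7$, $n\ne10$: $\mathrm{ex}^{(2)}(n;\{M_2,C_3\})=\max\{10,n\}$, $\mathrm{ex}^{(3)}(n;\{M_2,C_3\})=\min\{10,n\}$, $$\mathrm{Ex}^{(2)}(n;\{M_2,C_3\})\cup\mathrm{Ex}^{(3)}(n;\{M_2,C_3\})=\{K_5\cup(n-5)K_1,\ H_0(n)\},$$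 and $\mathrm{ex}^{(s)}(n;\{M_2,C_3\})$ does not exist for $s\ge4$.
   Context: Here $n\ge1$ is an integer. A 3-graph $H$ is a finite vertex set $V(H)$ together with a set of 3-element subsets of $V(H)$, called edges; $|H|$ denotes its number of edges. All 3-graphs are considered up to isomorphism: $G\subseteq H$ means that $H$ contains a copy of $G$ (a sub-3-graph isomorphic to $G$), and the families $\mathrm{Ex}^{(s)}$ are sets of isomorphism types. $H\cup sK_1$ denotes the 3-graph obtained from $H$ by adding $s$ isolated vertices. $M_2$ is the 3-graph consisting of two disjoint edges. The triangle is the 3-graph $C_3=\{\{x_1,y_3,x_2\},\{x_1,y_2,x_3\},\{x_2,y_1,x_3\}\}$ on six different vertices $x_1,x_2,x_3,y_1,y_2,y_3$. $K_m$ is the 3-graph of all triples on $m$ vertices. $S_n$ (full star) is the $n$-vertex 3-graph of all $\binom{n-1}{2}$ triples containing one fixed vertex. For $n\ge 6$ and distinct vertices $x,y,z,v$ of an $n$-element set $V$, $H_0(n)=\{f\in\binom V3: \{x,y\}\subset f\}\cup\{\{x,z,v\},\{y,z,v\}\}$. For a family $\mathcal G$ of 3-graphs, $H$ is $\mathcal G$-free if $G\not\subseteq H$ for all $G\in\mathcal G$. $\mathrm{ex}^{(1)}(n;\mathcal G)$ is the maximum of $|H|$ over $n$-vertex $\mathcal G$-free 3-graphs $H$, and $\mathrm{Ex}^{(1)}(n;\mathcal G)$ is the family of $n$-vertex $\mathcal G$-free 3-graphs attaining this maximum. Iteratively, for $s\ge1$, $\mathrm{ex}^{(s+1)}(n;\mathcal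 G)$ is the maximum of $|H|$ over all $n$-vertex $\mathcal G$-free 3-graphs $H$ such that $H\not\subseteq H'$ for every $H'\in\mathrm{Ex}^{(1)}(n;\mathcal G)\cup\dots\cup\mathrm{Ex}^{(s)}(n;\mathcal G)$, if such an $H$ exists (otherwise $\mathrm{ex}^{(s+1)}(n;\mathcal G)$ does not exist); $\mathrm{Ex}^{(s+1)}(n;\mathcal G)$ is the family of all such $H$ attaining the maximum. *)

theory Defs
  imports Complex_Main
begin

text \<open>A 3-graph is a pair of a vertex set and an edge set. Every finite 3-graph has an isomorphic
  copy whose vertices are natural numbers, so vertices of type \<^typ>\<open>nat\<close> lose no isomorphism type.\<close>

type_synonym hgraph = "nat set \<times> nat set set"

abbreviation verts :: "hgraph \<Rightarrow> nat set" where "verts \<equiv> fst"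
abbreviation edges :: "hgraph \<Rightarrow> nat set set" where "edges \<equiv> snd"
abbreviation num_edges :: "hgraph \<Rightarrow> nat" where "num_edges H \<equiv> card (edges H)"

definition triples :: "nat set \<Rightarrow> nat set set" where
  "triples V = {e. e \<subseteq> V \<and> card e = 3}"

definition three_graph :: "hgraph \<Rightarrow> bool" where
  "three_graph H \<longleftrightarrow> finite (verts H) \<and> edges H \<subseteq> triples (verts H)"

definition isomorphic :: "hgraph \<Rightarrow> hgraph \<Rightarrow> bool" where
  "isomorphic G H \<longleftrightarrow> (\<exists>f. bij_betw f (verts G) (verts H) \<and> (\<lambda>e. f ` e) ` edges G = edges H)"

definition iso_rel :: "(hgraph \<times> hgraph) set" where
  "iso_rel = {(G, H). three_graph G \<and> three_graph H \<and> isomorphic G H}"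

definition iso_type :: "hgraph \<Rightarrow> hgraph set" where
  "iso_type H = iso_rel `` {H}"

definition contains_copy :: "hgraph \<Rightarrow> hgraph \<Rightarrow> bool" where
  "contains_copy H G \<longleftrightarrow>
    (\<exists>G'. three_graph G' \<and> verts G' \<subseteq> verts H \<and> edges G' \<subseteq> edges H \<and> isomorphic G' G)"

definition free_of :: "hgraph set \<Rightarrow> hgraph \<Rightarrow> bool" where
  "free_of \<G> H \<longleftrightarrow> (\<forall>G\<in>\<G>. \<not> contains_copy H G)"

definition max_edge :: "hgraph set \<Rightarrow> hgraph set" where
  "max_edge A = {H \<in> A. \<forall>G\<in>A. num_edges G \<le> num_edges H}"

text \<open>\<open>admissible s n \<G>\<close> consists of the 3-graphs competing for the \<open>s\<close>-th Turan number; it is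
  meant for \<open>s \<ge> 1\<close>, and for \<open>s = 1\<close> the last conjunct is void.\<close>

fun admissible :: "nat \<Rightarrow> nat \<Rightarrow> hgraph set \<Rightarrow> hgraph set" where
  "admissible s n \<G> = {H. three_graph H \<and> card (verts H) = n \<and> free_of \<G> H \<and>
     (\<forall>t\<in>{1..<s}. \<forall>H'\<in>max_edge (admissible t n \<G>). \<not> contains_copy H' H)}"

text \<open>The equation above rewrites indefinitely.\<close>

declare admissible.simps [simp del]

text \<open>\<^const>\<open>None\<close> means that the \<open>s\<close>-th Turan number does not exist. Otherwise the maximum ranges
  over a finite set of numbers, all at most \<open>n choose 3\<close>.\<close>

definition turan_ex :: "nat \<Rightarrow> nat \<Rightarrow> hgraph set \<Rightarrow> nat option" where
  "turan_ex s n \<G> = (if admissible s n \<G> = {} then None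
     else Some (Max (num_edges ` admissible s n \<G>)))"

definition turan_Ex :: "nat \<Rightarrow> nat \<Rightarrow> hgraph set \<Rightarrow> hgraph set set" where
  "turan_Ex s n \<G> = iso_type ` max_edge (admissible s n \<G>)"

definition M2 :: hgraph where
  "M2 = ({0, 1, 2, 3, 4, 5}, {{0, 1, 2}, {3, 4, 5}})"

text \<open>Here \<open>x\<^sub>1, x\<^sub>2, x\<^sub>3 = 0, 1, 2\<close> and \<open>y\<^sub>1, y\<^sub>2, y\<^sub>3 = 3, 4, 5\<close>.\<close>

definition C3 :: hgraph where
  "C3 = ({0, 1, 2, 3, 4, 5}, {{0, 5, 1}, {0, 4, 2}, {1, 3, 2}})"

definition complete_graph :: "nat \<Rightarrow> hgraph" where
  "complete_graph m = ({..<m}, triples {..<m})"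

definition star :: "nat \<Rightarrow> hgraph" where
  "star n = ({..<n}, {e \<in> triples {..<n}. 0 \<in> e})"

text \<open>Here \<open>x, y, z, v = 0, 1, 2, 3\<close>; the definition is meant for \<open>n \<ge> 6\<close>.\<close>

definition H0 :: "nat \<Rightarrow> hgraph" where
  "H0 n = ({..<n}, {f \<in> triples {..<n}. {0, 1} \<subseteq> f} \<union> {{0, 2, 3}, {1, 2, 3}})"

text \<open>The \<open>s\<close> new vertices are the numbers from the least strict upper bound of the old vertices on.\<close>

definition add_isolated :: "hgraph \<Rightarrow> nat \<Rightarrow> hgraph" where
  "add_isolated H s =
    (let m = (LEAST m. \<forall>v\<in>verts H. v < m) in (verts H \<union> {m..<m + s}, edges H))"

end

theory Submission
  imports Defs
begin

text \<open>If two edges \<open>{a, b, c}\<close> and \<open>{a, d, e}\<close> of an \<open>{M\<^sub>2, C\<^sub>3}\<close>-free 3-graph share only \<open>a\<close>, then every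
  edge avoiding \<open>a\<close> lies in \<open>{b, c, d, e}\<close>. Applying this to such a pair and to the pairs it
  produces, and noting that triples meeting pairwise in two points share a point or lie in a 4-set, shows that every \<open>{M\<^sub>2, C\<^sub>3}\<close>-free 3-graph is contained in a full star, in \<open>K\<^sub>5\<close> or in
  \<open>H\<^sub>0\<close>. For \<open>n \<ge> 6\<close> these three are free themselves and pairwise incomparable, so the hierarchy just
  removes them in order of decreasing number of edges.\<close>

section \<open>Embeddings of 3-graphs\<close>

text \<open>The forbidden 3-graphs matter only through the way edges intersect, so the combinatorics
  is done for arbitrary families of triples; the graph side then needs only injective
  edge-preserving maps. The maxima range over all sets of \<open>n\<close> naturals as vertex sets,
  so every level contains all relabelled copies of its extremal 3-graphs. Levels are therefore
  described by a condition invariant under isomorphism, namely which maximal 3-graphs a competitor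
  lies below. Discarding one maximal 3-graph discards everything below it but leaves the others in
  play, because none lies below another. The three edge numbers are \<open>(n - 1) choose 2\<close>,
  \<open>10 = 5 choose 3\<close> and \<open>n = (n - 2) + 2\<close>. Their coincidences produce the
  special cases: at \<open>n = 6\<close> the star ties with \<open>K\<^sub>5\<close>, at
  \<open>n = 10\<close> the graph \<open>H\<^sub>0\<close> does. The bound \<open>n \<ge> 6\<close>
  is needed because the star and \<open>H\<^sub>0\<close> leave no vertex isolated, so they fit into
  \<open>K\<^sub>5\<close> plus isolated vertices only on at most five vertices; there, every
  3-graph is free and \<open>K\<^sub>n\<close> alone is maximal.\<close>

definition embedding :: "(nat \<Rightarrow> nat) \<Rightarrow> hgraph \<Rightarrow> hgraph \<Rightarrow> bool" where
  "embedding f G H \<longleftrightarrow> inj_on f (verts G) \<and> f ` verts G \<subseteq> verts H \<and> (\<forall>e\<in>edges G. f ` e \<in> edges H)"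

lemma three_graph_edge:
  assumes "three_graph H" "e \<in> edges H"
  shows "e \<subseteq> verts H" "card e = 3" "finite e"
  using assms by (auto simp: three_graph_def triples_def intro: finite_subset)

lemma finite_edges: "three_graph H \<Longrightarrow> finite (edges H)"
  by (rule finite_subset[of _ "Pow (verts H)"]) (auto simp: three_graph_def triples_def)

text \<open>The hypothesis on \<open>G\<close> puts every edge inside the vertex set, where the
  inverse of \<open>f\<close> undoes \<open>f\<close>.\<close>

lemma isomorphic_sym:
  assumes "three_graph G" "isomorphic G H"
  shows "isomorphic H G"
proof -
  obtain f where f: "bij_betw f (verts G) (verts H)" "(\<lambda>e. f ` e) ` edges G = edges H"
    using assms(2) by (auto simp: isomorphic_def)
  let ?g = "inv_into (verts G) f"
  have "?g ` f ` e = e" if "e \<in> edges G" for e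
    using f(1) three_graph_edge(1)[OF assms(1) that]
    by (simp add: bij_betw_def inv_into_image_cancel)
  then have "(\<lambda>e. ?g ` e) ` edges H = edges G"
    unfolding f(2)[symmetric] image_image[of "(`) ?g"] by simp
  then show ?thesis
    using bij_betw_inv_into[OF f(1)] by (auto simp: isomorphic_def)
qed

lemma isomorphic_trans:
  assumes "isomorphic G H" "isomorphic H K"
  shows "isomorphic G K"
proof -
  obtain f g where f: "bij_betw f (verts G) (verts H)" "(\<lambda>e. f ` e) ` edges G = edges H"
    and g: "bij_betw g (verts H) (verts K)" "(\<lambda>e. g ` e) ` edges H = edges K"
    using assms by (auto simp: isomorphic_def)
  have "(\<lambda>e. (g \<circ> f) ` e) ` edges G = edges K"
    unfolding g(2)[symmetric] f(2)[symmetric] by (simp only: image_comp[symmetric] image_image)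
  then show ?thesis
    using bij_betw_trans[OF f(1) g(1)] unfolding isomorphic_def by blast
qed

lemma iso_type_eq:
  assumes "three_graph G" "three_graph H" "isomorphic G H"
  shows "iso_type G = iso_type H"
proof -
  have "isomorphic G K \<longleftrightarrow> isomorphic H K" for K
    using isomorphic_trans[of H G K] isomorphic_trans[of G H K] isomorphic_sym[OF assms(1,3)] assms(3)
    by blast
  with assms show ?thesis by (simp add: iso_type_def iso_rel_def Image_def)
qed

text \<open>Replaces a sub-3-graph with an isomorphism by a single map, which can be composed. In
  the converse direction the copy is the image of \<open>G\<close>: injectivity keeps its edges at
  three vertices.\<close>

lemma contains_copy_iff:
  assumes G: "three_graph G"
  shows "contains_copy H G \<longleftrightarrow> (\<exists>f. embedding f G H)"
proof
  assume "contains_copy H G"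
  then obtain G' where G': "three_graph G'" "verts G' \<subseteq> verts H" "edges G' \<subseteq> edges H" "isomorphic G' G"
    by (auto simp: contains_copy_def)
  then obtain f where "bij_betw f (verts G) (verts G')" "(\<lambda>e. f ` e) ` edges G = edges G'"
    using isomorphic_sym[OF G'(1,4)] by (auto simp: isomorphic_def)
  with G' have "embedding f G H" by (auto simp: embedding_def bij_betw_def)
  then show "\<exists>f. embedding f G H" by blast
next
  assume "\<exists>f. embedding f G H"
  then obtain f where f: "embedding f G H" ..
  let ?G = "(f ` verts G, (\<lambda>e. f ` e) ` edges G)"
  have "card (f ` e) = 3" if "e \<in> edges G" for e
    using f three_graph_edge[OF G that] card_image[of f e] inj_on_subset[of f "verts G" e]
    by (simp add: embedding_def)
  then have tg: "three_graph ?G"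
    using G three_graph_edge(1)[OF G] by (auto simp: three_graph_def triples_def)
  have "isomorphic G ?G"
    using f by (auto simp: isomorphic_def embedding_def bij_betw_def)
  then have "isomorphic ?G G" using G isomorphic_sym by blast
  with tg f show "contains_copy H G"
    unfolding contains_copy_def embedding_def by (intro exI[of _ ?G]) auto
qed

lemma contains_copy_refl: "three_graph G \<Longrightarrow> contains_copy G G"
  using contains_copy_iff[of G G] by (auto simp: embedding_def intro!: exI[of _ id])

lemma contains_copy_trans:
  assumes "three_graph G" "three_graph H" "contains_copy H G" "contains_copy K H"
  shows "contains_copy K G"
proof -
  obtain f g where fg: "embedding f G H" "embedding g H K"
    using assms contains_copy_iff by blast
  have "inj_on (g \<circ> f) (verts G)"
    using fg comp_inj_on[of f "verts G" g] inj_on_subset[of g "verts H" "f ` verts G"]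
    by (simp add: embedding_def)
  moreover have "(g \<circ> f) ` verts G \<subseteq> verts K"
    using fg by (auto simp: embedding_def)
  moreover have "(g \<circ> f) ` e \<in> edges K" if "e \<in> edges G" for e
    unfolding image_comp[symmetric] using fg that by (simp only: embedding_def)
  ultimately have "embedding (g \<circ> f) G K" by (simp add: embedding_def)
  then show ?thesis using assms(1) contains_copy_iff by blast
qed

lemma isomorphic_imp_contains_copy:
  assumes "three_graph G" "isomorphic G H"
  shows "contains_copy H G"
proof -
  obtain f where f: "bij_betw f (verts G) (verts H)" "(\<lambda>e. f ` e) ` edges G = edges H"
    using assms(2) by (auto simp: isomorphic_def)
  then have "embedding f G H" by (auto simp: embedding_def bij_betw_def)
  then show ?thesis using contains_copy_iff[OF assms(1)] by blast
qed

lemma embedding_inj_on_edges: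
  assumes "three_graph G" "embedding f G H"
  shows "inj_on (\<lambda>e. f ` e) (edges G)"
proof (rule inj_onI)
  fix d e assume "d \<in> edges G" "e \<in> edges G" "f ` d = f ` e"
  with assms show "d = e"
    using inj_on_image_eq_iff[of f "verts G" d e] three_graph_edge(1)[OF assms(1)]
    by (simp add: embedding_def)
qed

lemma contains_copy_num_edges:
  assumes "three_graph G" "three_graph H" "contains_copy H G"
  shows "num_edges G \<le> num_edges H"
proof -
  obtain f where f: "embedding f G H" using assms contains_copy_iff by blast
  then have "(\<lambda>e. f ` e) ` edges G \<subseteq> edges H" by (auto simp: embedding_def)
  then show ?thesis
    by (rule card_inj_on_le[OF embedding_inj_on_edges[OF assms(1) f] _ finite_edges[OF assms(2)]])
qed

text \<open>An injection into a finite set that is no larger is onto; this is applied once to the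
  vertices and once to the induced map on edges. It turns equality of edge numbers into
  isomorphism.\<close>

lemma contains_copy_imp_isomorphic:
  assumes tg: "three_graph G" "three_graph H" and copy: "contains_copy H G"
    and "card (verts G) = card (verts H)" "num_edges H \<le> num_edges G"
  shows "isomorphic G H"
proof -
  obtain f where f: "embedding f G H" using tg copy contains_copy_iff by blast
  then have inj: "inj_on f (verts G)" and sub: "f ` verts G \<subseteq> verts H"
    "(\<lambda>e. f ` e) ` edges G \<subseteq> edges H"
    by (auto simp: embedding_def)
  have "card (f ` verts G) = card (verts H)" using assms(4) card_image[OF inj] by simp
  then have "bij_betw f (verts G) (verts H)"
    using card_subset_eq[OF _ sub(1)] tg(2) inj by (simp add: three_graph_def bij_betw_def)
  moreover have "num_edges H \<le> card ((\<lambda>e. f ` e) ` edges G)"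
    using assms(5) card_image[OF embedding_inj_on_edges[OF tg(1) f]] by simp
  then have "(\<lambda>e. f ` e) ` edges G = edges H"
    using card_seteq[OF finite_edges[OF tg(2)] sub(2)] by simp
  ultimately show ?thesis by (auto simp: isomorphic_def)
qed

section \<open>The hierarchy below an antichain of maximal 3-graphs\<close>

definition antichain :: "nat \<Rightarrow> hgraph set \<Rightarrow> bool" where
  "antichain n \<P> \<longleftrightarrow> (\<forall>P\<in>\<P>. three_graph P \<and> card (verts P) = n) \<and>
     (\<forall>P\<in>\<P>. \<forall>Q\<in>\<P>. P \<noteq> Q \<longrightarrow> \<not> contains_copy P Q)"

text \<open>The down-set of \<open>\<P>\<close> minus that of \<open>\<R>\<close>, on
  \<open>n\<close> vertices. With \<open>\<P>\<close> the maximal free 3-graphs and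
  \<open>\<R>\<close> those already used up, this is one level of the hierarchy.\<close>

definition covered :: "nat \<Rightarrow> hgraph set \<Rightarrow> hgraph set \<Rightarrow> hgraph set" where
  "covered n \<P> \<R> = {H. three_graph H \<and> card (verts H) = n \<and>
     (\<exists>P\<in>\<P>. contains_copy P H) \<and> (\<forall>P\<in>\<R>. \<not> contains_copy P H)}"

lemma subset_covered:
  assumes "antichain n \<P>" "\<R> \<subseteq> \<P>"
  shows "\<P> - \<R> \<subseteq> covered n \<P> \<R>"
proof
  fix P assume P: "P \<in> \<P> - \<R>"
  have "three_graph P" "card (verts P) = n" using P assms by (simp_all add: antichain_def)
  moreover have "\<not> contains_copy Q P" if "Q \<in> \<R>" for Q
  proof -
    have "Q \<in> \<P>" "Q \<noteq> P" using that P assms(2) by auto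
    then show ?thesis using P assms(1) unfolding antichain_def by blast
  qed
  ultimately show "P \<in> covered n \<P> \<R>"
    using P contains_copy_refl unfolding covered_def by blast
qed

text \<open>A largest \<open>H\<close> lies below some \<open>P\<close> outside \<open>\<R>\<close>.
  By the antichain property \<open>P\<close> competes as well, so \<open>H\<close> has as many edges
  as \<open>P\<close> and fills it. Conversely, any competitor lies below some remaining
  \<open>Q\<close>, which has no more edges than a largest \<open>P\<close>.\<close>

lemma max_edge_covered:
  assumes \<P>: "antichain n \<P>" and \<R>: "\<R> \<subseteq> \<P>"
  shows "max_edge (covered n \<P> \<R>) = {H. three_graph H \<and> (\<exists>P\<in>max_edge (\<P> - \<R>). isomorphic H P)}"
    (is "_ = ?M")
proof
  show "max_edge (covered n \<P> \<R>) \<subseteq> ?M"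
  proof
    fix H assume "H \<in> max_edge (covered n \<P> \<R>)"
    then have H: "H \<in> covered n \<P> \<R>" "\<And>G. G \<in> covered n \<P> \<R> \<Longrightarrow> num_edges G \<le> num_edges H"
      by (auto simp: max_edge_def)
    then obtain P where P: "P \<in> \<P> - \<R>" "contains_copy P H" "three_graph H" "card (verts H) = n"
      by (auto simp: covered_def)
    have tgP: "three_graph P" "card (verts P) = n" using P \<P> by (auto simp: antichain_def)
    have PH: "num_edges P \<le> num_edges H" using H(2) P(1) subset_covered[OF \<P> \<R>] by blast
    have HP: "num_edges H \<le> num_edges P" using contains_copy_num_edges P tgP by blast
    have "isomorphic H P" using contains_copy_imp_isomorphic P tgP PH by simp
    moreover have "P \<in> max_edge (\<P> - \<R>)"
      unfolding max_edge_def using P(1) HP H(2) subset_covered[OF \<P> \<R>] by (blast intro: order_trans)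
    ultimately show "H \<in> ?M" using P by blast
  qed
next
  show "?M \<subseteq> max_edge (covered n \<P> \<R>)"
  proof
    fix H assume "H \<in> ?M"
    then obtain P where H: "three_graph H" and P: "P \<in> \<P> - \<R>" "isomorphic H P"
      and max: "\<And>Q. Q \<in> \<P> - \<R> \<Longrightarrow> num_edges Q \<le> num_edges P"
      unfolding max_edge_def by blast
    have tgP: "three_graph P" "card (verts P) = n" using P \<P> by (auto simp: antichain_def)
    have HP: "contains_copy P H" using isomorphic_imp_contains_copy H P by blast
    have PH: "contains_copy H P" using isomorphic_imp_contains_copy isomorphic_sym H P tgP by blast
    have "card (verts H) = n"
      using P(2) tgP(2) by (auto simp: isomorphic_def dest: bij_betw_same_card)
    moreover have "\<not> contains_copy Q H" if "Q \<in> \<R>" for Q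
    proof -
      have "Q \<in> \<P>" "Q \<noteq> P" using that P \<R> by auto
      then have "\<not> contains_copy Q P" using P \<P> unfolding antichain_def by blast
      then show ?thesis using contains_copy_trans[OF tgP(1) H PH] by blast
    qed
    ultimately have "H \<in> covered n \<P> \<R>" using H HP P unfolding covered_def by blast
    moreover have "num_edges G \<le> num_edges H" if "G \<in> covered n \<P> \<R>" for G
    proof -
      obtain Q where Q: "Q \<in> \<P> - \<R>" "contains_copy Q G" "three_graph G"
        using \<open>G \<in> covered n \<P> \<R>\<close> unfolding covered_def by blast
      then have "num_edges G \<le> num_edges Q"
        using contains_copy_num_edges \<P> by (auto simp: antichain_def)
      also have "\<dots> \<le> num_edges P" using max Q by blast
      also have "\<dots> \<le> num_edges H" using contains_copy_num_edges[OF tgP(1) H PH] .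
      finally show ?thesis .
    qed
    ultimately show "H \<in> max_edge (covered n \<P> \<R>)" unfolding max_edge_def by blast
  qed
qed

section \<open>From one level of the hierarchy to the next\<close>

lemma admissible_1: "admissible 1 n \<G> = {H. three_graph H \<and> card (verts H) = n \<and> free_of \<G> H}"
  by (subst admissible.simps) simp

text \<open>The exclusions from levels below \<open>s\<close> are already built into level
  \<open>s\<close>; only the exclusion by level \<open>s\<close> itself is new. For
  \<open>s = 0\<close> the range \<open>{1..<Suc s}\<close> would be empty.\<close>

lemma admissible_Suc:
  assumes "s \<ge> 1"
  shows "admissible (Suc s) n \<G> =
    {H \<in> admissible s n \<G>. \<forall>H'\<in>max_edge (admissible s n \<G>). \<not> contains_copy H' H}"
proof -
  have "{1..<Suc s} = insert s {1..<s}" using assms by auto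
  then show ?thesis by (subst (1 2) admissible.simps) auto
qed

lemma admissible_antimono:
  assumes "1 \<le> s" "s \<le> t"
  shows "admissible t n \<G> \<subseteq> admissible s n \<G>"
  using assms(2) by (induction rule: dec_induct) (use assms(1) admissible_Suc in auto)

context
  fixes n s :: nat and \<G> \<P> \<R> :: "hgraph set"
  assumes \<P>: "antichain n \<P>" and \<R>: "\<R> \<subseteq> \<P>" and s: "s \<ge> 1"
    and adm: "admissible s n \<G> = covered n \<P> \<R>"
begin

text \<open>The 3-graphs excluded next are the relabelled copies of members of
  \<open>max_edge (\<P> - \<R>)\<close>. Lying below a copy is the same as lying below the member
  itself, so \<open>\<R>\<close> grows by exactly these members.\<close>

lemma admissible_Suc_covered:
  "admissible (Suc s) n \<G> = covered n \<P> (\<R> \<union> max_edge (\<P> - \<R>))"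
proof -
  have "(\<forall>H'\<in>max_edge (covered n \<P> \<R>). \<not> contains_copy H' H) \<longleftrightarrow>
        (\<forall>P\<in>max_edge (\<P> - \<R>). \<not> contains_copy P H)" if H: "three_graph H" for H
  proof (intro iffI ballI notI)
    fix P assume *: "\<forall>H'\<in>max_edge (covered n \<P> \<R>). \<not> contains_copy H' H"
      "P \<in> max_edge (\<P> - \<R>)" "contains_copy P H"
    then have "three_graph P" using \<P> by (auto simp: max_edge_def antichain_def)
    moreover have "isomorphic P P" by (auto simp: isomorphic_def intro!: exI[of _ id])
    ultimately show False using * max_edge_covered[OF \<P> \<R>] by blast
  next
    fix H' assume *: "\<forall>P\<in>max_edge (\<P> - \<R>). \<not> contains_copy P H"
      "H' \<in> max_edge (covered n \<P> \<R>)" "contains_copy H' H"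
    then obtain P where "three_graph H'" "P \<in> max_edge (\<P> - \<R>)" "isomorphic H' P"
      using max_edge_covered[OF \<P> \<R>] by auto
    then show False
      using * H isomorphic_imp_contains_copy contains_copy_trans by blast
  qed
  then show ?thesis
    unfolding admissible_Suc[OF s] adm unfolding covered_def by blast
qed

lemma turan_ex_covered:
  assumes "P \<in> max_edge (\<P> - \<R>)"
  shows "turan_ex s n \<G> = Some (num_edges P)"
proof -
  have tgP: "three_graph P" using assms \<P> by (auto simp: max_edge_def antichain_def)
  have "isomorphic P P" by (auto simp: isomorphic_def intro!: exI[of _ id])
  then have P: "P \<in> max_edge (covered n \<P> \<R>)"
    using assms tgP max_edge_covered[OF \<P> \<R>] by blast
  \<comment> \<open>The level may be infinite, as the vertex set is arbitrary; the bound makes its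
    set of edge numbers finite, as \<open>Max\<close> requires.\<close>
  then have le: "num_edges ` covered n \<P> \<R> \<subseteq> {..num_edges P}" by (auto simp: max_edge_def)
  have "Max (num_edges ` covered n \<P> \<R>) = num_edges P"
    using le P by (intro Max_eqI) (auto simp: max_edge_def intro: finite_subset)
  then show ?thesis using P by (auto simp: turan_ex_def adm max_edge_def)
qed

lemma turan_Ex_covered: "turan_Ex s n \<G> = iso_type ` max_edge (\<P> - \<R>)"
proof -
  have tg: "three_graph P" if "P \<in> max_edge (\<P> - \<R>)" for P
    using that \<P> by (auto simp: max_edge_def antichain_def)
  moreover have "isomorphic P P" for P :: hgraph
    by (auto simp: isomorphic_def intro!: exI[of _ id])
  ultimately have "max_edge (\<P> - \<R>) \<subseteq> max_edge (covered n \<P> \<R>)"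
    unfolding max_edge_covered[OF \<P> \<R>] by blast
  moreover have "iso_type H \<in> iso_type ` max_edge (\<P> - \<R>)" if "H \<in> max_edge (covered n \<P> \<R>)" for H
    using that iso_type_eq tg unfolding max_edge_covered[OF \<P> \<R>] by blast
  ultimately show ?thesis unfolding turan_Ex_def adm by blast
qed

text \<open>Once every maximal 3-graph is used up nothing is left, and later levels only
  shrink.\<close>

lemma turan_ex_None:
  assumes "\<R> = \<P>" "t \<ge> s"
  shows "turan_ex t n \<G> = None"
proof -
  have "admissible s n \<G> = {}" unfolding adm using assms(1) by (auto simp: covered_def)
  then have "admissible t n \<G> = {}" using admissible_antimono[OF s assms(2)] by blast
  then show ?thesis by (simp add: turan_ex_def)
qed

end

section \<open>Triples without disjoint pairs and triangles\<close>

text \<open>For triples this is \<open>{M2, C3}\<close>-freeness, see \<open>free_of_iff\<close>.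
  The empty common intersection separates a triangle from three edges that pairwise share one and
  the same vertex.\<close>

definition triangle_free_intersecting :: "'a set set \<Rightarrow> bool" where
  "triangle_free_intersecting F \<longleftrightarrow> (\<forall>e\<in>F. \<forall>f\<in>F. e \<inter> f \<noteq> {}) \<and>
     \<not> (\<exists>e\<in>F. \<exists>f\<in>F. \<exists>g\<in>F. card (e \<inter> f) = 1 \<and> card (e \<inter> g) = 1 \<and> card (f \<inter> g) = 1 \<and> e \<inter> f \<inter> g = {})"

lemma card_3_eq:
  assumes "card e = 3" "a \<in> e" "b \<in> e" "c \<in> e" "distinct [a, b, c]"
  shows "e = {a, b, c}"
proof -
  have "finite e" using assms(1) by (auto intro: card_ge_0_finite)
  then show ?thesis using assms card_subset_eq[of e "{a, b, c}"] by auto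
qed

text \<open>\<open>g\<close> meets both edges outside \<open>a\<close>, and meeting each in a single
  vertex would give a triangle. So \<open>g\<close> contains one of the pairs \<open>{b, c}\<close>,
  \<open>{d, e}\<close> and a vertex of the other, which accounts for all three of its
  elements.\<close>

lemma triangle_free_intersecting_avoid:
  assumes F: "triangle_free_intersecting F" and "{a, b, c} \<in> F" "{a, d, e} \<in> F"
    and dist: "distinct [a, b, c, d, e]" and g: "g \<in> F" "card g = 3" "a \<notin> g"
  shows "g \<subseteq> {b, c, d, e}"
proof -
  have m: "g \<inter> {a, b, c} \<noteq> {}" "g \<inter> {a, d, e} \<noteq> {}"
    using assms by (auto simp: triangle_free_intersecting_def)
  have i: "{a, b, c} \<inter> {a, d, e} = {a}" using dist by auto
  have "card ({a, b, c} \<inter> {a, d, e}) = 1" "{a, b, c} \<inter> {a, d, e} \<inter> g = {}"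
    unfolding i using g(3) by auto
  then have "\<not> (card ({a, b, c} \<inter> g) = 1 \<and> card ({a, d, e} \<inter> g) = 1)"
    using F assms(2,3) g(1) unfolding triangle_free_intersecting_def by blast
  then have "b \<in> g \<and> c \<in> g \<or> d \<in> g \<and> e \<in> g"
    using m g(3) by (auto simp: Int_insert_left split: if_splits)
  moreover have "b \<in> g \<or> c \<in> g" "d \<in> g \<or> e \<in> g" using m g(3) by auto
  ultimately consider "b \<in> g" "c \<in> g" "d \<in> g" | "b \<in> g" "c \<in> g" "e \<in> g"
    | "d \<in> g" "e \<in> g" "b \<in> g" | "d \<in> g" "e \<in> g" "c \<in> g"
    by blast
  then show ?thesis
    using dist by cases (auto dest: card_3_eq[OF g(2)])
qed

lemma card_3_obtain:
  assumes "card e = 3" "a \<in> e"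
  obtains b c where "e = {a, b, c}" "distinct [a, b, c]"
proof -
  obtain x y z where "e = {x, y, z}" "x \<noteq> y" "y \<noteq> z" "x \<noteq> z"
    using assms(1) by (auto simp: card_3_iff)
  then show thesis
    using assms(2) that[of y z] that[of x z] that[of x y] by (auto simp: insert_commute)
qed

text \<open>The conclusion is either that all triples lie in \<open>{a, b, c, d, e}\<close>, or \<open>H\<^sub>0\<close> with
  \<open>x, y, z, v = a, d, b, c\<close>.\<close>

lemma triangle_free_intersecting_bowtie:
  assumes F: "triangle_free_intersecting F" "\<And>f. f \<in> F \<Longrightarrow> card f = 3"
    and abc: "{a, b, c} \<in> F" and ade: "{a, d, e} \<in> F" and bcd: "{b, c, d} \<in> F"
    and dist: "distinct [a, b, c, d, e]"
  shows "(\<forall>f\<in>F. f \<subseteq> {a, b, c, d, e}) \<or>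
    (\<forall>f\<in>F. {a, d} \<subseteq> f \<or> f = {a, b, c} \<or> f = {d, b, c})"
proof (rule disjCI)
  assume "\<not> (\<forall>f\<in>F. {a, d} \<subseteq> f \<or> f = {a, b, c} \<or> f = {d, b, c})"
  then obtain g where g: "g \<in> F" "\<not> {a, d} \<subseteq> g" "g \<noteq> {a, b, c}" "g \<noteq> {d, b, c}" by blast
  have dae: "{d, a, e} \<in> F" and dbc: "{d, b, c} \<in> F"
    using ade bcd by (simp_all add: insert_commute)
  show "\<forall>f\<in>F. f \<subseteq> {a, b, c, d, e}"
  proof (rule ccontr)
    assume "\<not> (\<forall>f\<in>F. f \<subseteq> {a, b, c, d, e})"
    then obtain h w where h: "h \<in> F" "w \<in> h" "w \<notin> {a, b, c, d, e}" by blast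
    have a: "f \<subseteq> {b, c, d, e}" if "f \<in> F" "a \<notin> f" for f
      using triangle_free_intersecting_avoid[OF F(1) abc ade _ that(1) F(2)[OF that(1)] that(2)] dist
      by auto
    have d: "f \<subseteq> {b, c, a, e}" if "f \<in> F" "d \<notin> f" for f
      using triangle_free_intersecting_avoid[OF F(1) dbc dae _ that(1) F(2)[OF that(1)] that(2)] dist
      by auto
    \<comment> \<open>\<open>w\<close> lies in neither of the two 4-sets above, so \<open>h\<close>
      can avoid neither \<open>a\<close> nor \<open>d\<close>.\<close>
    have adh: "a \<in> h" "d \<in> h" using a[OF h(1)] d[OF h(1)] h by auto
    then have h_eq: "h = {a, d, w}"
      using card_3_eq[OF F(2)[OF h(1)] adh h(2)] h(3) dist by auto
    have adw: "{a, d, w} \<in> F" "{d, a, w} \<in> F" using h(1) h_eq by (auto simp: insert_commute)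
    \<comment> \<open>\<open>{a, d, w}\<close> can take the place of \<open>{a, d, e}\<close> in
      both pairs. An edge without \<open>a\<close> then lies in \<open>{b, c, d, e}\<close> and in
      \<open>{b, c, d, w}\<close>, hence in \<open>{b, c, d}\<close>; likewise an edge without
      \<open>d\<close> lies in \<open>{a, b, c}\<close>.\<close>
    have aw: "f \<subseteq> {b, c, d, w}" if "f \<in> F" "a \<notin> f" for f
      using triangle_free_intersecting_avoid[OF F(1) abc adw(1) _ that(1) F(2)[OF that(1)] that(2)] dist h(3)
      by auto
    have dw: "f \<subseteq> {b, c, a, w}" if "f \<in> F" "d \<notin> f" for f
      using triangle_free_intersecting_avoid[OF F(1) dbc adw(2) _ that(1) F(2)[OF that(1)] that(2)] dist h(3)
      by auto
    have sub: "g \<subseteq> {b, c, d} \<or> g \<subseteq> {a, b, c}"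
    proof (cases "a \<in> g")
      case True
      then have "d \<notin> g" using g(2) by auto
      then show ?thesis using d[OF g(1)] dw[OF g(1)] h(3) by auto
    next
      case False
      then show ?thesis using a[OF g(1)] aw[OF g(1)] h(3) by auto
    qed
    have "card {b, c, d} = 3" "card {a, b, c} = 3" using dist by auto
    then have "g = {b, c, d} \<or> g = {a, b, c}"
      using sub F(2)[OF g(1)] card_subset_eq[of "{b, c, d}" g] card_subset_eq[of "{a, b, c}" g] by auto
    then show False using g(3,4) by auto
  qed
qed

text \<open>The split is whether some two edges share exactly one vertex. The alternatives may
  overlap: \<open>star\<close> absorbs the empty family, and \<open>five\<close> the families inside
  a 4-set.\<close>

lemma triangle_free_intersecting_classification:
  fixes F :: "'a set set"
  assumes F: "triangle_free_intersecting F" "\<forall>f\<in>F. card f = 3"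
  obtains (star) x where "\<forall>f\<in>F. x \<in> f"
    | (five) S where "finite S" "card S \<le> 5" "\<forall>f\<in>F. f \<subseteq> S"
    | (book) x y z v where "distinct [x, y, z, v]" "{x, z, v} \<in> F" "{y, z, v} \<in> F"
        "\<forall>f\<in>F. {x, y} \<subseteq> f \<or> f = {x, z, v} \<or> f = {y, z, v}"
proof -
  note F = F(1) bspec[OF F(2)]
  have fin: "finite f" if "f \<in> F" for f using F(2)[OF that] by (auto intro: card_ge_0_finite)
  consider (none) "F = {}" | (bowtie) e f where "e \<in> F" "f \<in> F" "card (e \<inter> f) = 1"
    | (dense) "F \<noteq> {}" "\<And>e f. e \<in> F \<Longrightarrow> f \<in> F \<Longrightarrow> card (e \<inter> f) \<ge> 2"
  proof (cases "\<exists>e\<in>F. \<exists>f\<in>F. card (e \<inter> f) = 1")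
    case False
    have "card (e \<inter> f) \<ge> 2" if ef: "e \<in> F" "f \<in> F" for e f
    proof -
      have "e \<inter> f \<noteq> {}" using F(1) ef by (auto simp: triangle_free_intersecting_def)
      then have "card (e \<inter> f) \<noteq> 0" using fin[OF ef(1)] by simp
      moreover have "card (e \<inter> f) \<noteq> 1" using False ef by blast
      ultimately show ?thesis by linarith
    qed
    then show ?thesis using none dense by blast
  qed blast
  then show thesis
  proof cases
    case none
    then show ?thesis using star by blast
  next
    case (bowtie e f)
    then obtain a where a: "e \<inter> f = {a}" by (auto simp: card_1_singleton_iff)
    obtain b c where e: "e = {a, b, c}" "distinct [a, b, c]"
      using card_3_obtain[of e a] F(2)[OF bowtie(1)] a by auto
    obtain d d' where f: "f = {a, d, d'}" "distinct [a, d, d']"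
      using card_3_obtain[of f a] F(2)[OF bowtie(2)] a by auto
    have dist: "distinct [a, b, c, d, d']" using a e f by auto
    show ?thesis
    proof (cases "\<forall>g\<in>F. a \<in> g")
      case False
      then obtain g where g: "g \<in> F" "a \<notin> g" by blast
      have gs: "g \<subseteq> {b, c, d, d'}"
        using triangle_free_intersecting_avoid[OF F(1) _ _ dist g(1) F(2)[OF g(1)] g(2)] bowtie e(1) f(1)
        by auto
      have "card ({b, c, d, d'} - g) = 1"
        using gs F(2)[OF g(1)] fin[OF g(1)] dist by (subst card_Diff_subset) auto
      then obtain t where t: "{b, c, d, d'} - g = {t}" by (auto simp: card_1_singleton_iff)
      have g_eq: "g = {b, c, d, d'} - {t}" using t gs by blast
      \<comment> \<open>By symmetry the labels can be chosen so that the omitted vertex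
        \<open>t\<close> takes the role of \<open>e\<close>, and the pair contained whole in
        \<open>g\<close> that of \<open>{b, c}\<close>. This is the configuration required by
        \<open>triangle_free_intersecting_bowtie\<close>.\<close>
      have H: "\<exists>a b c d e. distinct [a, b, c, d, e] \<and> {a, b, c} \<in> F \<and> {a, d, e} \<in> F \<and> {b, c, d} \<in> F"
      proof -
        have "t \<in> {b, c, d, d'}" using t by blast
        then consider "t = d'" | "t = d" | "t = b" | "t = c" by blast
        then show ?thesis
        proof cases
          case 1
          then have "g = {b, c, d}" using g_eq dist by auto
          then show ?thesis using bowtie g(1) e(1) f(1) dist by blast
        next
          case 2
          then have "g = {b, c, d'}" using g_eq dist by auto
          moreover have "{a, d', d} \<in> F" "distinct [a, b, c, d', d]"
            using bowtie f(1) dist by (auto simp: insert_commute)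
          ultimately show ?thesis using bowtie g(1) e(1) by blast
        next
          case 3
          then have "g = {d, d', c}" using g_eq dist by auto
          moreover have "{a, c, b} \<in> F" "distinct [a, d, d', c, b]"
            using bowtie e(1) dist by (auto simp: insert_commute)
          ultimately show ?thesis using bowtie g(1) f(1) by blast
        next
          case 4
          then have "g = {d, d', b}" using g_eq dist by auto
          moreover have "{a, b, c} \<in> F" "distinct [a, d, d', b, c]"
            using bowtie e(1) dist by (auto simp: insert_commute)
          ultimately show ?thesis using bowtie g(1) f(1) by blast
        qed
      qed
      obtain a b c d e where dist: "distinct [a, b, c, d, e]" and *: "{a, b, c} \<in> F" "{a, d, e} \<in> F" "{b, c, d} \<in> F"
        using H by blast
      from triangle_free_intersecting_bowtie[OF F * dist] show ?thesis
      proof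
        assume "\<forall>f\<in>F. f \<subseteq> {a, b, c, d, e}"
        moreover have "card {a, b, c, d, e} \<le> 5" using dist by simp
        ultimately show ?thesis using five[of "{a, b, c, d, e}"] by blast
      next
        assume "\<forall>f\<in>F. {a, d} \<subseteq> f \<or> f = {a, b, c} \<or> f = {d, b, c}"
        then show ?thesis using book[of a d b c] dist *(1,3) by (auto simp: insert_commute)
      qed
    qed (use star in blast)
  next
    case dense
    then obtain e where e: "e \<in> F" by blast
    then obtain a b c where abc: "e = {a, b, c}" "a \<noteq> b" "a \<noteq> c" "b \<noteq> c"
      using F(2)[OF e] by (auto simp: card_3_iff)
    show ?thesis
    proof (cases "\<forall>f\<in>F. a \<in> f")
      case False
      then obtain f where f: "f \<in> F" "a \<notin> f" by blast
      have two: "(a \<in> h \<and> b \<in> h) \<or> (a \<in> h \<and> c \<in> h) \<or> (b \<in> h \<and> c \<in> h)" if "h \<in> F" for h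
      proof (rule ccontr)
        assume "\<not> ?thesis"
        then have "e \<inter> h \<subseteq> {a} \<or> e \<inter> h \<subseteq> {b} \<or> e \<inter> h \<subseteq> {c}" using abc by auto
        then have "card (e \<inter> h) \<le> 1" using card_mono[of "{_}" "e \<inter> h"] by fastforce
        then show False using dense(2)[OF e that] by simp
      qed
      \<comment> \<open>\<open>f\<close> shares two vertices with \<open>{a, b, c}\<close> but
        misses \<open>a\<close>.\<close>
      have bc: "b \<in> f" "c \<in> f" using two[OF f(1)] f(2) by auto
      have "\<not> f \<subseteq> {b, c}" using F(2)[OF f(1)] card_mono[of "{b, c}" f] abc(4) by auto
      then obtain d where d': "d \<in> f" "d \<noteq> b" "d \<noteq> c" by blast
      then have d: "f = {b, c, d}" "d \<noteq> b" "d \<noteq> c"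
        using card_3_eq[OF F(2)[OF f(1)] bc d'(1)] abc(4) by auto
      have "d \<noteq> a" using d f by auto
      show ?thesis
      proof (cases "\<forall>h\<in>F. h \<subseteq> {a, b, c, d}")
        case True
        moreover have "card {a, b, c, d} \<le> 5" using card_insert_le_m1[of 5 "{b,c,d}" a] by (simp add: card_insert_if)
        ultimately show ?thesis using five[of "{a, b, c, d}"] by blast
      next
        case False
        \<comment> \<open>An edge leaving the 4-set and missing \<open>b\<close> or \<open>c\<close>
          would need \<open>a\<close> to share two vertices with \<open>e\<close>, and
          \<open>d\<close> to share two with \<open>f\<close>. Together with the outer vertex and
          one of \<open>b\<close>, \<open>c\<close> these are four vertices.\<close>
        have out: "b \<in> h \<and> c \<in> h" if h: "h \<in> F" "\<not> h \<subseteq> {a, b, c, d}" for h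
        proof (rule ccontr)
          assume n: "\<not> ?thesis"
          then have ah: "a \<in> h" using two[OF h(1)] by auto
          obtain w where w: "w \<in> h" "w \<notin> {a, b, c, d}" using h(2) by blast
          have "d \<in> h"
          proof (rule ccontr)
            assume "d \<notin> h"
            then have "f \<inter> h \<subseteq> {b} \<or> f \<inter> h \<subseteq> {c}" using d n by auto
            then have "card (f \<inter> h) \<le> 1" using card_mono[of "{_}" "f \<inter> h"] by fastforce
            then show False using dense(2)[OF f(1) h(1)] by simp
          qed
          moreover have "b \<in> h \<or> c \<in> h" using two[OF h(1)] by auto
          ultimately have "{a, d, w, b} \<subseteq> h \<or> {a, d, w, c} \<subseteq> h" using ah w by auto
          moreover have "card {a, d, w, b} = 4" "card {a, d, w, c} = 4"
            using w abc d \<open>d \<noteq> a\<close> by auto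
          ultimately show False using F(2)[OF h(1)] fin[OF h(1)] card_mono[of h "{a, d, w, b}"] card_mono[of h "{a, d, w, c}"]
            by auto
        qed
        obtain h w where h: "h \<in> F" "w \<in> h" "w \<notin> {a, b, c, d}" using False by blast
        then have bch: "b \<in> h" "c \<in> h" using out[of h] by auto
        then have h_eq: "h = {b, c, w}"
          using card_3_eq[OF F(2)[OF h(1)] bch h(2)] h(3) abc by auto
        \<comment> \<open>An edge without \<open>b\<close> stays inside the 4-set by
          \<open>out\<close>, so it can share only \<open>c\<close> with
          \<open>h = {b, c, w}\<close>.\<close>
        have "b \<in> k" if k: "k \<in> F" for k
        proof (rule ccontr)
          assume b: "b \<notin> k"
          then have "k \<subseteq> {a, b, c, d}" using out[OF k] by blast
          then have "h \<inter> k \<subseteq> {c}" using b h h_eq by auto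
          then have "card (h \<inter> k) \<le> 1" using card_mono[of "{_}" "h \<inter> k"] by fastforce
          then show False using dense(2)[OF h(1) k] by simp
        qed
        then show ?thesis using star by blast
      qed
    qed (use star in blast)
  qed
qed

section \<open>The three extremal 3-graphs\<close>

lemma triangle_free_intersecting_star: "\<forall>f\<in>F. x \<in> f \<Longrightarrow> triangle_free_intersecting F"
  unfolding triangle_free_intersecting_def by blast

text \<open>Two disjoint triples need six points. In a triangle, two edges sharing one vertex
  already cover all five points, so the third is the union of its two one-point intersections with
  them, too small for a triple.\<close>

lemma triangle_free_intersecting_five:
  assumes S: "finite S" "card S \<le> 5" and F: "\<forall>f\<in>F. f \<subseteq> S \<and> card f = 3"
  shows "triangle_free_intersecting F"
  unfolding triangle_free_intersecting_def
proof (intro conjI ballI notI)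
  have sub: "finite f" "f \<subseteq> S" "card f = 3" if "f \<in> F" for f
    using F S that by (auto intro: finite_subset)
  have le: "card (e \<union> f) \<le> 5" if "e \<in> F" "f \<in> F" for e f
    using sub[OF that(1)] sub[OF that(2)] card_mono[OF S(1), of "e \<union> f"] S(2) by simp
  {
    fix e f assume ef: "e \<in> F" "f \<in> F" "e \<inter> f = {}"
    then show False
      using card_Un_disjoint[of e f] le[OF ef(1,2)] sub[OF ef(1)] sub[OF ef(2)] by simp
  }
  assume "\<exists>e\<in>F. \<exists>f\<in>F. \<exists>g\<in>F. card (e \<inter> f) = 1 \<and> card (e \<inter> g) = 1 \<and> card (f \<inter> g) = 1 \<and> e \<inter> f \<inter> g = {}"
  then obtain e f g where efg: "e \<in> F" "f \<in> F" "g \<in> F" "card (e \<inter> f) = 1" "card (e \<inter> g) = 1" "card (f \<inter> g) = 1"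
    by blast
  have "card (e \<union> f) = 5"
    using card_Un_Int[of e f] sub[OF efg(1)] sub[OF efg(2)] efg(4) by simp
  then have "e \<union> f = S"
    using card_seteq[OF S(1), of "e \<union> f"] S(2) sub(2)[OF efg(1)] sub(2)[OF efg(2)] by simp
  then have "g = (e \<inter> g) \<union> (f \<inter> g)" using sub(2)[OF efg(3)] by blast
  then have "card g \<le> 2" using card_Un_le[of "e \<inter> g" "f \<inter> g"] efg(5,6) by simp
  then show False using sub(3)[OF efg(3)] by simp
qed

text \<open>Every edge contains \<open>{x, y}\<close> or \<open>{z, v}\<close>. By the pigeonhole
  principle two of any three edges contain the same pair, so they share at least two vertices and no
  triangle arises.\<close>

lemma triangle_free_intersecting_book:
  assumes dist: "distinct [x, y, z, v]" and fin: "\<forall>f\<in>F. finite f"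
    and F: "\<forall>f\<in>F. {x, y} \<subseteq> f \<or> f = {x, z, v} \<or> f = {y, z, v}"
  shows "triangle_free_intersecting F"
  unfolding triangle_free_intersecting_def
proof (intro conjI ballI notI)
  show False if "e \<in> F" "f \<in> F" "e \<inter> f = {}" for e f
    using bspec[OF F that(1)] bspec[OF F that(2)] that(3) by auto
  have pair: "\<not> ({p, q} \<subseteq> e \<and> {p, q} \<subseteq> f)" if "p \<noteq> q" "e \<in> F" "f \<in> F" "card (e \<inter> f) = 1" for p q e f
    using that card_mono[of "e \<inter> f" "{p, q}"] fin by auto
  have alt: "{x, y} \<subseteq> f \<or> {z, v} \<subseteq> f" if "f \<in> F" for f
    using bspec[OF F that] by auto
  assume "\<exists>e\<in>F. \<exists>f\<in>F. \<exists>g\<in>F. card (e \<inter> f) = 1 \<and> card (e \<inter> g) = 1 \<and> card (f \<inter> g) = 1 \<and> e \<inter> f \<inter> g = {}"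
  then obtain e f g where efg: "e \<in> F" "f \<in> F" "g \<in> F" "card (e \<inter> f) = 1" "card (e \<inter> g) = 1" "card (f \<inter> g) = 1"
    by blast
  have ne: "x \<noteq> y" "z \<noteq> v" using dist by auto
  show False
    using alt[OF efg(1)] alt[OF efg(2)] alt[OF efg(3)]
      pair[OF ne(1) efg(1,2,4)] pair[OF ne(1) efg(1,3,5)] pair[OF ne(1) efg(2,3,6)]
      pair[OF ne(2) efg(1,2,4)] pair[OF ne(2) efg(1,3,5)] pair[OF ne(2) efg(2,3,6)] by argo
qed

section \<open>Freeness as a condition on edge intersections\<close>

lemma three_graph_M2: "three_graph M2"
  by (simp add: three_graph_def triples_def M2_def)

lemma three_graph_C3: "three_graph C3"
  by (simp add: three_graph_def triples_def C3_def)

text \<open>Embeddings of \<open>M2\<close> and \<open>C3\<close> are given by listing the images of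
  the vertices 0 to 5.\<close>

lemma inj_on_nth_six:
  assumes "distinct [a, b, c, d, e, f]"
  shows "inj_on ((!) [a, b, c, d, e, f]) {0, 1, 2, 3, 4, 5}"
  using inj_on_nth[OF assms, of "{0, 1, 2, 3, 4, 5}"] by simp

lemma free_of_iff:
  assumes H: "three_graph H"
  shows "free_of {M2, C3} H \<longleftrightarrow> triangle_free_intersecting (edges H)"
proof
  assume F: "triangle_free_intersecting (edges H)"
  have "\<not> embedding f M2 H" for f
  proof
    assume f: "embedding f M2 H"
    then have inj: "inj_on f {0, 1, 2, 3, 4, 5}" by (simp add: embedding_def M2_def)
    have "f ` {0, 1, 2} \<inter> f ` {3, 4, 5} = {}"
      using inj_on_image_Int[OF inj, of "{0, 1, 2}" "{3, 4, 5}"] by simp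
    moreover have "f ` {0, 1, 2} \<in> edges H" "f ` {3, 4, 5} \<in> edges H"
      using f unfolding embedding_def M2_def by (simp_all del: image_insert)
    ultimately show False using F unfolding triangle_free_intersecting_def by blast
  qed
  moreover have "\<not> embedding f C3 H" for f
  proof
    assume f: "embedding f C3 H"
    then have inj: "inj_on f {0, 1, 2, 3, 4, 5}" by (simp add: embedding_def C3_def)
    have I: "f ` {0, 5, 1} \<inter> f ` {0, 4, 2} = f ` {0}" "f ` {0, 5, 1} \<inter> f ` {1, 3, 2} = f ` {1}"
      "f ` {0, 4, 2} \<inter> f ` {1, 3, 2} = f ` {2}"
      using inj_on_image_Int[OF inj, of "{0, 5, 1}" "{0, 4, 2}"] inj_on_image_Int[OF inj, of "{0, 5, 1}" "{1, 3, 2}"]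
        inj_on_image_Int[OF inj, of "{0, 4, 2}" "{1, 3, 2}"] by (simp_all del: image_insert)
    have "f 0 \<notin> f ` {1, 3, 2}"
      using inj_on_image_mem_iff[OF inj, of 0 "{1, 3, 2}"] by (simp del: image_insert)
    then have "f ` {0, 5, 1} \<inter> f ` {0, 4, 2} \<inter> f ` {1, 3, 2} = {}"
      unfolding I(1) by blast
    moreover have "card (f ` {0, 5, 1} \<inter> f ` {0, 4, 2}) = 1" "card (f ` {0, 5, 1} \<inter> f ` {1, 3, 2}) = 1"
      "card (f ` {0, 4, 2} \<inter> f ` {1, 3, 2}) = 1"
      unfolding I by simp_all
    moreover have "f ` {0, 5, 1} \<in> edges H" "f ` {0, 4, 2} \<in> edges H" "f ` {1, 3, 2} \<in> edges H"
      using f unfolding embedding_def C3_def by (simp_all del: image_insert)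
    ultimately show False
      using F unfolding triangle_free_intersecting_def by blast
  qed
  ultimately show "free_of {M2, C3} H"
    using contains_copy_iff three_graph_M2 three_graph_C3 unfolding free_of_def by blast
next
  assume "free_of {M2, C3} H"
  then have no: "\<not> embedding f M2 H" "\<not> embedding f C3 H" for f
    using contains_copy_iff three_graph_M2 three_graph_C3 unfolding free_of_def by blast+
  show "triangle_free_intersecting (edges H)"
    unfolding triangle_free_intersecting_def
  proof (intro conjI ballI notI)
    fix e f assume ef: "e \<in> edges H" "f \<in> edges H" "e \<inter> f = {}"
    obtain a b c where e: "e = {a, b, c}" "a \<noteq> b" "a \<noteq> c" "b \<noteq> c"
      using three_graph_edge(2)[OF H ef(1)] by (auto simp: card_3_iff)
    obtain p q r where f: "f = {p, q, r}" "p \<noteq> q" "p \<noteq> r" "q \<noteq> r"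
      using three_graph_edge(2)[OF H ef(2)] by (auto simp: card_3_iff)
    have "distinct [a, b, c, p, q, r]" using e f ef(3) by auto
    from inj_on_nth_six[OF this] have "embedding ((!) [a, b, c, p, q, r]) M2 H"
      using ef three_graph_edge(1)[OF H] e(1) f(1) by (auto simp: embedding_def M2_def)
    then show False using no by blast
  next
    assume "\<exists>e\<in>edges H. \<exists>f\<in>edges H. \<exists>g\<in>edges H.
      card (e \<inter> f) = 1 \<and> card (e \<inter> g) = 1 \<and> card (f \<inter> g) = 1 \<and> e \<inter> f \<inter> g = {}"
    then obtain e f g a b c where efg: "e \<in> edges H" "f \<in> edges H" "g \<in> edges H"
      and I: "e \<inter> f = {a}" "e \<inter> g = {b}" "f \<inter> g = {c}" "e \<inter> f \<inter> g = {}"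
      unfolding card_1_singleton_iff by (auto simp: card_1_singleton_iff)
    have ne: "a \<noteq> b" "a \<noteq> c" "b \<noteq> c" using I by auto
    have third: "\<exists>r. h = {p, q, r} \<and> r \<noteq> p \<and> r \<noteq> q" if h: "h \<in> edges H" "p \<in> h" "q \<in> h" "p \<noteq> q" for h p q
    proof -
      obtain s t where "h = {p, s, t}" "distinct [p, s, t]"
        using card_3_obtain[OF three_graph_edge(2)[OF H h(1)] h(2)] .
      then show ?thesis using h(3,4) by (auto simp: insert_commute)
    qed
    \<comment> \<open>The vertices \<open>a\<close>, \<open>b\<close>, \<open>c\<close> play
      \<open>x\<^sub>1\<close>, \<open>x\<^sub>2\<close>, \<open>x\<^sub>3\<close>, and each primed
      vertex plays the corresponding \<open>y\<close>: it is the third vertex of the edge missing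
      its unprimed namesake. Two equal primed vertices would lie in a pairwise intersection, which
      is already a single unprimed vertex.\<close>
    obtain c' where e: "e = {a, b, c'}" "c' \<noteq> a" "c' \<noteq> b" using third[of e a b] efg(1) I ne by blast
    obtain b' where f: "f = {a, c, b'}" "b' \<noteq> a" "b' \<noteq> c" using third[of f a c] efg(2) I ne by blast
    obtain a' where g: "g = {b, c, a'}" "a' \<noteq> b" "a' \<noteq> c" using third[of g b c] efg(3) I ne by blast
    have mem: "a' \<in> g" "b' \<in> f" "c' \<in> e" unfolding e f g by simp_all
    have "a \<notin> g" "b \<notin> f" "c \<notin> e" using I by blast+
    then have "a \<noteq> a'" "b \<noteq> b'" "c \<noteq> c'" using mem by metis+
    moreover have "a' \<noteq> b'" "a' \<noteq> c'" "b' \<noteq> c'"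
      using mem I(1-3) e(2,3) f(2,3) g(2,3) by (metis IntI singletonD)+
    ultimately have "distinct [a, b, c, a', b', c']" using ne e(2,3) f(2,3) g(2,3) by simp
    from inj_on_nth_six[OF this] have "embedding ((!) [a, b, c, a', b', c']) C3 H"
      using efg three_graph_edge(1)[OF H] e(1) f(1) g(1)
      by (auto simp: embedding_def C3_def insert_commute)
    then show False using no by blast
  qed
qed

section \<open>Edge numbers of the extremal 3-graphs\<close>

lemma add_isolated_complete_graph: "add_isolated (complete_graph k) s = ({..<k + s}, triples {..<k})"
proof -
  have "(LEAST m. \<forall>v\<in>{..<k}. v < m) = k"
  proof (rule Least_equality)
    show "k \<le> m" if "\<forall>v\<in>{..<k}. v < m" for m
      using that by (metis lessThan_iff linorder_not_le less_irrefl)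
  qed simp
  moreover have "{..<k} \<union> {k..<k + s} = {..<k + s}" by auto
  ultimately show ?thesis by (simp add: add_isolated_def complete_graph_def)
qed

lemma triples_mono: "A \<subseteq> B \<Longrightarrow> triples A \<subseteq> triples B"
  by (auto simp: triples_def)

lemma card_triples: "finite V \<Longrightarrow> card (triples V) = card V choose 3"
  unfolding triples_def by (rule n_subsets)

lemma three_graph_complete_graph: "three_graph (complete_graph n)"
  by (simp add: three_graph_def complete_graph_def)

lemma three_graph_star: "three_graph (star n)"
  by (auto simp: three_graph_def star_def)

lemma three_graph_add_isolated: "three_graph (add_isolated (complete_graph k) s)"
  by (simp add: three_graph_def add_isolated_complete_graph triples_mono)

lemma three_graph_H0: "n \<ge> 4 \<Longrightarrow> three_graph (H0 n)"
  by (auto simp: three_graph_def H0_def triples_def)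

lemma num_edges_star:
  assumes "n \<ge> 1"
  shows "num_edges (star n) = (n - 1) choose 2"
proof -
  have "bij_betw (insert 0) {e. e \<subseteq> {1..<n} \<and> card e = 2} (edges (star n))"
  proof (rule bij_betw_byWitness[where f' = "\<lambda>e. e - {0}"])
    show "insert 0 ` {e. e \<subseteq> {1..<n} \<and> card e = 2} \<subseteq> edges (star n)"
    proof safe
      fix e assume e: "e \<subseteq> {1..<n}" "card e = 2"
      then have "finite e" "0 \<notin> e" by (auto intro: card_ge_0_finite)
      with e assms show "insert 0 e \<in> edges (star n)"
        by (auto simp: star_def triples_def)
    qed
    show "(\<lambda>e. e - {0}) ` edges (star n) \<subseteq> {e. e \<subseteq> {1..<n} \<and> card e = 2}"
      by (force simp: star_def triples_def)
  qed (auto simp: star_def)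
  then have "card {e. e \<subseteq> {1..<n} \<and> card e = 2} = num_edges (star n)"
    by (rule bij_betw_same_card)
  then show ?thesis using n_subsets[of "{1..<n}" 2] by simp
qed

lemma num_edges_add_isolated: "num_edges (add_isolated (complete_graph k) s) = k choose 3"
  by (simp add: add_isolated_complete_graph card_triples)

text \<open>The edges through 0 and 1 are determined by their third vertex, which gives
  \<open>n - 2\<close>; the two extra edges each miss one of 0 and 1.\<close>

lemma num_edges_H0:
  assumes "n \<ge> 4"
  shows "num_edges (H0 n) = n"
proof -
  have "bij_betw (\<lambda>w. {0, 1, w}) {2..<n} {f \<in> triples {..<n}. {0, 1} \<subseteq> f}"
  proof (rule bij_betwI')
    fix f assume "f \<in> {f \<in> triples {..<n}. {0, 1} \<subseteq> f}"
    then have f: "card f = 3" "0 \<in> f" "1 \<in> f" "f \<subseteq> {..<n}" by (auto simp: triples_def)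
    then have "\<not> f \<subseteq> {0, 1}" using card_mono[of "{0, 1}" f] by auto
    then obtain w where w: "w \<in> f" "w \<noteq> 0" "w \<noteq> 1" by blast
    then have "f = {0, 1, w}" using card_3_eq[OF f(1-3) w(1)] by simp
    then show "\<exists>w\<in>{2..<n}. f = {0, 1, w}" using w f(4) by (intro bexI[of _ w]) auto
  next
    show "{0, 1, w} \<in> {f \<in> triples {..<n}. {0, 1} \<subseteq> f}" if "w \<in> {2..<n}" for w
      using that by (auto simp: triples_def)
  next
    fix v w assume v: "v \<in> {2..<n}"
    have "v = w" if "{0, 1, v} = {0, 1, w}"
    proof -
      have "v \<in> {0, 1, w}" using that by blast
      then show ?thesis using v by auto
    qed
    then show "{0, 1, v} = {0, 1, w} \<longleftrightarrow> v = w" by blast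
  qed
  from bij_betw_same_card[OF this]
  have "card {f \<in> triples {..<n}. {0, 1} \<subseteq> f} = n - 2" by simp
  moreover have "{0, 2, 3} \<noteq> {1, 2, 3::nat}" by auto
  moreover have "finite {f \<in> triples {..<n}. {0, 1} \<subseteq> f}"
    by (auto simp: triples_def)
  ultimately show ?thesis
    using assms by (simp add: H0_def card_Un_disjoint)
qed

section \<open>Placing a free 3-graph inside an extremal one\<close>

text \<open>The extremal 3-graphs live on \<open>{..<n}\<close> with their special vertices first;
  \<open>xs\<close> lists the vertices that are to become special.\<close>

lemma exists_enumeration:
  assumes "finite V" "distinct xs" "set xs \<subseteq> V"
  obtains g where "bij_betw g V {..<card V}" "\<And>i. i < length xs \<Longrightarrow> g (xs ! i) = i"
proof -
  obtain ys where ys: "set ys = V - set xs" "distinct ys"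
    using finite_distinct_list assms(1) by blast
  let ?zs = "xs @ ys"
  have zs: "distinct ?zs" "set ?zs = V" using ys assms by auto
  then have len: "length ?zs = card V" by (metis distinct_card)
  have bij: "bij_betw ((!) ?zs) {..<card V} V"
    using bij_betw_nth[OF zs(1) _ refl] zs(2) len by metis
  show thesis
  proof
    show "bij_betw (inv_into {..<card V} ((!) ?zs)) V {..<card V}"
      using bij_betw_inv_into[OF bij] .
    fix i assume i: "i < length xs"
    then have "inv_into {..<card V} ((!) ?zs) (?zs ! i) = i"
      using bij len by (intro inv_into_f_f) (auto simp: bij_betw_def)
    then show "inv_into {..<card V} ((!) ?zs) (xs ! i) = i" using i by (simp add: nth_append)
  qed
qed

lemma image_triples:
  assumes "bij_betw g V W" "e \<in> triples V"
  shows "g ` e \<in> triples W"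
proof -
  have "inj_on g e" using assms by (auto simp: bij_betw_def triples_def intro: inj_on_subset)
  then show ?thesis using assms card_image[of g e] by (auto simp: bij_betw_def triples_def)
qed

text \<open>A numbering of the vertices maps edges to triples automatically, so only the property
  that singles out the edges in \<open>F\<close> remains to be checked.\<close>

lemma contains_copy_enumeration:
  assumes H: "three_graph H" and g: "bij_betw g (verts H) {..<n}"
    and "\<And>e. e \<in> edges H \<Longrightarrow> g ` e \<in> triples {..<n} \<Longrightarrow> g ` e \<in> F"
  shows "contains_copy ({..<n}, F) H"
proof -
  have "g ` e \<in> triples {..<n}" if "e \<in> edges H" for e
    using image_triples[OF g] H that unfolding three_graph_def by blast
  then have "embedding g H ({..<n}, F)" using assms by (simp add: embedding_def bij_betw_def)
  then show ?thesis using contains_copy_iff[OF H] by blast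
qed

lemma contains_copy_complete_graph:
  assumes H: "three_graph H"
  shows "contains_copy (complete_graph (card (verts H))) H"
proof -
  obtain g where "bij_betw g (verts H) {..<card (verts H)}"
    using exists_enumeration[of "verts H" "[]"] H by (auto simp: three_graph_def)
  then show ?thesis
    unfolding complete_graph_def by (rule contains_copy_enumeration[OF H])
qed

lemma triangle_free_intersecting_contained:
  assumes H: "three_graph H" "card (verts H) = n" and n: "n \<ge> 6"
    and F: "triangle_free_intersecting (edges H)"
  shows "\<exists>P\<in>{star n, add_isolated (complete_graph 5) (n - 5), H0 n}. contains_copy P H"
proof -
  have fin: "finite (verts H)" and sub: "\<And>e. e \<in> edges H \<Longrightarrow> e \<subseteq> verts H"
    using H three_graph_edge(1) by (auto simp: three_graph_def)
  have "\<forall>e\<in>edges H. card e = 3" using three_graph_edge(2)[OF H(1)] by blast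
  with F show ?thesis
  proof (cases rule: triangle_free_intersecting_classification)
    case (star x)
    \<comment> \<open>Without edges \<open>star\<close> says nothing about \<open>x\<close>, which
      need not even be a vertex; then any vertex serves as centre.\<close>
    obtain x' where x': "x' \<in> verts H" "\<forall>e\<in>edges H. x' \<in> e"
    proof (cases "edges H = {}")
      case True
      have "verts H \<noteq> {}" using H(2) n by auto
      then show ?thesis using True that by blast
    next
      case False
      then show ?thesis using star sub that by blast
    qed
    obtain g where g: "bij_betw g (verts H) {..<n}" "\<And>i. i < length [x'] \<Longrightarrow> g ([x'] ! i) = i"
      using exists_enumeration[OF fin, of "[x']"] x' H(2) by auto
    have "contains_copy (star n) H"
      unfolding star_def
      by (rule contains_copy_enumeration[OF H(1) g(1)]) (use g(2)[of 0] x' in force)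
    then show ?thesis by blast
  next
    case (five S)
    \<comment> \<open>\<open>S\<close> may contain points that are not vertices. The vertices in it
      are numbered first, so they receive numbers below 5.\<close>
    obtain xs where xs: "set xs = S \<inter> verts H" "distinct xs"
      using finite_distinct_list[of "S \<inter> verts H"] five(1) by blast
    have len: "length xs \<le> 5"
      using distinct_card[OF xs(2)] xs(1) card_mono[OF five(1), of "S \<inter> verts H"] five(2) by simp
    obtain g where g: "bij_betw g (verts H) {..<n}" "\<And>i. i < length xs \<Longrightarrow> g (xs ! i) = i"
      using exists_enumeration[OF fin xs(2)] xs(1) H(2) by auto
    have "g x < 5" if "x \<in> S \<inter> verts H" for x
      using that g(2) len unfolding xs(1)[symmetric] in_set_conv_nth by force
    then have "g ` e \<subseteq> {..<5}" if "e \<in> edges H" for e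
      using sub[OF that] five(3) that by blast
    then have "contains_copy ({..<n}, triples {..<5}) H"
      by (intro contains_copy_enumeration[OF H(1) g(1)]) (auto simp: triples_def)
    then show ?thesis using n by (simp add: add_isolated_complete_graph)
  next
    case (book x y z v)
    have "set [x, y, z, v] \<subseteq> verts H" using sub[OF book(2)] sub[OF book(3)] by simp
    then obtain g where g: "bij_betw g (verts H) {..<n}"
      "\<And>i. i < length [x, y, z, v] \<Longrightarrow> g ([x, y, z, v] ! i) = i"
      using exists_enumeration[OF fin book(1)] H(2) by auto
    have gs: "g x = 0" "g y = 1" "g z = 2" "g v = 3"
      using g(2)[of 0] g(2)[of 1] g(2)[of 2] g(2)[of 3] by simp_all
    have g_edge: "{0, 1} \<subseteq> g ` e \<or> g ` e = {0, 2, 3} \<or> g ` e = {1, 2, 3}" if "e \<in> edges H" for e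
    proof -
      have "g ` {x, y} \<subseteq> g ` e \<or> g ` e = g ` {x, z, v} \<or> g ` e = g ` {y, z, v}"
        using book(4) that by blast
      then show ?thesis by (simp add: gs)
    qed
    have "contains_copy (H0 n) H"
      unfolding H0_def
    proof (rule contains_copy_enumeration[OF H(1) g(1)])
      fix e assume "e \<in> edges H" "g ` e \<in> triples {..<n}"
      then show "g ` e \<in> {f \<in> triples {..<n}. {0, 1} \<subseteq> f} \<union> {{0, 2, 3}, {1, 2, 3}}"
        using g_edge[of e] unfolding Un_iff mem_Collect_eq insert_iff empty_iff by argo
    qed
    then show ?thesis by blast
  qed
qed

section \<open>Pairwise incomparability of the extremal 3-graphs\<close>

text \<open>The preimage of the centre lies in every edge. An edge is needed because otherwise the
  centre may have no preimage.\<close>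

lemma embedding_star_common_vertex:
  assumes "three_graph G" "embedding f G (star n)" "edges G \<noteq> {}"
  shows "\<exists>x. \<forall>e\<in>edges G. x \<in> e"
proof -
  have zero: "0 \<in> f ` e" if "e \<in> edges G" for e
    using assms(2) that by (auto simp: embedding_def star_def)
  obtain d x where d: "d \<in> edges G" "x \<in> d" "f x = 0" using assms(3) zero by fastforce
  have "x \<in> e" if e: "e \<in> edges G" for e
  proof -
    obtain y where y: "y \<in> e" "f y = 0" using zero[OF e] by fastforce
    have "y \<in> verts G" "x \<in> verts G"
      using y d three_graph_edge(1)[OF assms(1)] e by blast+
    then have "y = x"
      using assms(2) d(3) y(2) inj_onD[of f "verts G" y x] by (simp add: embedding_def)
    then show ?thesis using y by simp
  qed
  then show ?thesis by blast
qed

text \<open>If every vertex of \<open>G\<close> lies in an edge, none can be sent to an added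
  isolated vertex, so all of \<open>G\<close> must fit into \<open>k\<close> vertices.\<close>

lemma embedding_add_isolated_card:
  assumes "three_graph G" "embedding f G (add_isolated (complete_graph k) s)" "verts G \<subseteq> \<Union>(edges G)"
  shows "card (verts G) \<le> k"
proof -
  have "f ` e \<subseteq> {..<k}" if "e \<in> edges G" for e
    using assms(2) that by (auto simp: embedding_def add_isolated_complete_graph triples_def)
  then have "f ` verts G \<subseteq> {..<k}" using assms(3) by blast
  then show ?thesis using assms(2) card_inj_on_le[of f "verts G" "{..<k}"] by (simp add: embedding_def)
qed

lemma H0_edges: "n \<ge> 4 \<Longrightarrow> w \<in> {2..<n} \<Longrightarrow> {0, 1, w} \<in> edges (H0 n)"
  by (auto simp: H0_def triples_def)

lemma H0_edge_meets: "e \<in> edges (H0 n) \<Longrightarrow> 0 \<in> e \<or> 1 \<in> e"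
  by (auto simp: H0_def)

lemma star_edges: "a \<in> {1..<n} \<Longrightarrow> b \<in> {1..<n} \<Longrightarrow> a \<noteq> b \<Longrightarrow> {0, a, b} \<in> edges (star n)"
  by (auto simp: star_def triples_def)

context
  fixes n :: nat
  assumes n: "n \<ge> 6"
begin

lemma not_contains_star_add_isolated: "\<not> contains_copy (star n) (add_isolated (complete_graph 5) s)"
proof
  let ?K = "add_isolated (complete_graph 5) s"
  assume "contains_copy (star n) ?K"
  then obtain f where f: "embedding f ?K (star n)"
    using contains_copy_iff[OF three_graph_add_isolated] by blast
  \<comment> \<open>The first two edges share only 0, which the third avoids.\<close>
  have K: "{0, 1, 2} \<in> edges ?K" "{0, 3, 4} \<in> edges ?K" "{1, 2, 3} \<in> edges ?K"
    by (auto simp: add_isolated_complete_graph triples_def)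
  then obtain x where x: "\<forall>e\<in>edges ?K. x \<in> e"
    using embedding_star_common_vertex[OF three_graph_add_isolated f] by blast
  show False using bspec[OF x K(1)] bspec[OF x K(2)] bspec[OF x K(3)] by auto
qed

lemma not_contains_star_H0: "\<not> contains_copy (star n) (H0 n)"
proof
  have tg: "three_graph (H0 n)" using n three_graph_H0 by simp
  assume "contains_copy (star n) (H0 n)"
  then obtain f where f: "embedding f (H0 n) (star n)"
    using contains_copy_iff[OF tg] by blast
  have K: "{0, 1, 4} \<in> edges (H0 n)" "{0, 2, 3} \<in> edges (H0 n)" "{1, 2, 3} \<in> edges (H0 n)"
    using H0_edges[of n 4] n by (auto simp: H0_def)
  then obtain x where x: "\<forall>e\<in>edges (H0 n). x \<in> e"
    using embedding_star_common_vertex[OF tg f] by blast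
  show False using bspec[OF x K(1)] bspec[OF x K(2)] bspec[OF x K(3)] by auto
qed

lemma not_contains_add_isolated_star: "\<not> contains_copy (add_isolated (complete_graph 5) s) (star n)"
proof
  assume "contains_copy (add_isolated (complete_graph 5) s) (star n)"
  then obtain f where f: "embedding f (star n) (add_isolated (complete_graph 5) s)"
    using contains_copy_iff[OF three_graph_star] by blast
  have "v \<in> \<Union>(edges (star n))" if "v < n" for v
  proof (cases "v \<le> 1")
    case True
    then have "{0, 1, 2} \<in> edges (star n)" "v \<in> {0, 1, 2}"
      using star_edges[of 1 n 2] n that by auto
    then show ?thesis by (rule UnionI)
  next
    case False
    then have "{0, 1, v} \<in> edges (star n)" "v \<in> {0, 1, v}"
      using star_edges[of 1 n v] n that by auto
    then show ?thesis by (rule UnionI)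
  qed
  then have "verts (star n) \<subseteq> \<Union>(edges (star n))" by (auto simp: star_def)
  then have "card (verts (star n)) \<le> 5" using embedding_add_isolated_card[OF three_graph_star f] by blast
  then show False using n by (simp add: star_def)
qed

lemma not_contains_add_isolated_H0: "\<not> contains_copy (add_isolated (complete_graph 5) s) (H0 n)"
proof
  have tg: "three_graph (H0 n)" using n three_graph_H0 by simp
  assume "contains_copy (add_isolated (complete_graph 5) s) (H0 n)"
  then obtain f where f: "embedding f (H0 n) (add_isolated (complete_graph 5) s)"
    using contains_copy_iff[OF tg] by blast
  have "v \<in> \<Union>(edges (H0 n))" if "v < n" for v
  proof (cases "v \<le> 1")
    case True
    then have "{0, 1, 2} \<in> edges (H0 n)" "v \<in> {0, 1, 2}"
      using H0_edges[of n 2] n that by auto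
    then show ?thesis by (rule UnionI)
  next
    case False
    then have "{0, 1, v} \<in> edges (H0 n)" "v \<in> {0, 1, v}"
      using H0_edges[of n v] n that by auto
    then show ?thesis by (rule UnionI)
  qed
  then have "verts (H0 n) \<subseteq> \<Union>(edges (H0 n))" by (auto simp: H0_def)
  then have "card (verts (H0 n)) \<le> 5" using embedding_add_isolated_card[OF tg f] by blast
  then show False using n by (simp add: H0_def)
qed

text \<open>The two vertices 0 and 1 meet every edge of \<open>H0 n\<close>, whereas deleting any
  two vertices from \<open>K\<^sub>5\<close> leaves a triple.\<close>

lemma not_contains_H0_add_isolated: "\<not> contains_copy (H0 n) (add_isolated (complete_graph 5) s)"
proof
  let ?K = "add_isolated (complete_graph 5) s"
  assume "contains_copy (H0 n) ?K"
  then obtain f where f: "embedding f ?K (H0 n)"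
    using contains_copy_iff[OF three_graph_add_isolated] by blast
  define A where "A = {i \<in> {..<5}. f i \<in> {0, 1}}"
  have A: "A \<subseteq> {..<5}" "finite A" by (auto simp: A_def)
  have "inj_on f {..<5}"
    using f by (auto simp: embedding_def add_isolated_complete_graph intro: inj_on_subset)
  then have "inj_on f A" using A(1) by (rule inj_on_subset)
  moreover have "f ` A \<subseteq> {0, 1}" by (auto simp: A_def)
  ultimately have "card A \<le> card {0, 1::nat}"
    by (intro card_inj_on_le) simp_all
  then have "card ({..<5} - A) \<ge> 3"
    using card_Diff_subset[OF A(2,1)] by simp
  then obtain e where e: "e \<subseteq> {..<5} - A" "card e = 3" "finite e"
    by (rule obtain_subset_with_card_n)
  then have "e \<in> edges ?K" by (auto simp: add_isolated_complete_graph triples_def)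
  then have "f ` e \<in> edges (H0 n)" using f by (simp add: embedding_def)
  then have "0 \<in> f ` e \<or> 1 \<in> f ` e" by (rule H0_edge_meets)
  then obtain i where i: "i \<in> e" "f i \<in> {0, 1}" by (metis imageE insert_iff)
  have "i \<in> {..<5} - A" using e(1) i(1) by (rule subsetD)
  then show False using i(2) by (simp add: A_def)
qed

text \<open>Since \<open>n - 2 \<ge> 4\<close>, the binomial coefficient is at least
  \<open>2 * (n - 1)\<close>. This excludes the star from \<open>H0 n\<close> by counting, and it
  puts the star ahead of \<open>H0 n\<close> in the hierarchy.\<close>

lemma star_beats_H0: "n < (n - 1) choose 2"
proof -
  have "(n - 1) * 4 \<le> (n - 1) * (n - 1 - 1)" using n by (intro mult_le_mono2) simp
  then have "(n - 1) * 4 div 2 \<le> (n - 1) choose 2" unfolding choose_two by (rule div_le_mono)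
  then show ?thesis using n by simp
qed

lemma not_contains_H0_star: "\<not> contains_copy (H0 n) (star n)"
  using contains_copy_num_edges[OF three_graph_star three_graph_H0, of n n] n star_beats_H0
  by (auto simp: num_edges_star num_edges_H0)

lemma antichain_extremal: "antichain n {star n, add_isolated (complete_graph 5) (n - 5), H0 n}"
proof -
  have "card (verts (star n)) = n" "card (verts (H0 n)) = n"
    "card (verts (add_isolated (complete_graph 5) (n - 5))) = n"
    using n by (simp_all add: star_def H0_def add_isolated_complete_graph)
  moreover have "three_graph (H0 n)" using n three_graph_H0 by simp
  ultimately show ?thesis
    unfolding antichain_def
    using three_graph_star three_graph_add_isolated not_contains_star_add_isolated not_contains_star_H0
      not_contains_add_isolated_star not_contains_add_isolated_H0 not_contains_H0_add_isolated
      not_contains_H0_star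
    by simp
qed

end

section \<open>The hierarchy\<close>

lemma max_edgeI:
  assumes "B \<subseteq> A" "B \<noteq> {}" "\<And>P. P \<in> B \<Longrightarrow> num_edges P = m" "\<And>P. P \<in> A - B \<Longrightarrow> num_edges P < m"
  shows "max_edge A = B"
proof
  have le: "num_edges P \<le> m" if "P \<in> A" for P
    using assms(3)[of P] assms(4)[of P] that by (cases "P \<in> B") simp_all
  show "B \<subseteq> max_edge A"
    using assms(1,3) le unfolding max_edge_def by fastforce
  show "max_edge A \<subseteq> B"
  proof
    fix P assume P: "P \<in> max_edge A"
    obtain Q where "Q \<in> B" using assms(2) by blast
    then have "m \<le> num_edges P" using P assms(1,3) unfolding max_edge_def by blast
    then show "P \<in> B" using P assms(4)[of P] unfolding max_edge_def by fastforce
  qed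
qed

lemma max_edge_singleton: "max_edge {P} = {P}"
  by (rule max_edgeI[of _ _ "num_edges P"]) simp_all

lemma triangle_free_intersecting_add_isolated:
  "triangle_free_intersecting (edges (add_isolated (complete_graph 5) s))"
  by (rule triangle_free_intersecting_five[of "{..<5}"])
    (auto simp: add_isolated_complete_graph triples_def)

lemma triangle_free_intersecting_H0: "triangle_free_intersecting (edges (H0 n))"
proof (rule triangle_free_intersecting_book)
  show "distinct [0, 1, 2, 3::nat]" by simp
  show "\<forall>f\<in>edges (H0 n). finite f"
    by (auto simp: H0_def triples_def intro: card_ge_0_finite)
  show "\<forall>f\<in>edges (H0 n). {0, 1} \<subseteq> f \<or> f = {0, 2, 3} \<or> f = {1, 2, 3}"
    unfolding H0_def by simp
qed

text \<open>Freeness passes to sub-3-graphs. So if the members of \<open>\<P>\<close> are free and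
  every free 3-graph lies below one of them, being free and lying below \<open>\<P>\<close>
  coincide.\<close>

lemma admissible_1_covered:
  assumes tg: "\<And>P. P \<in> \<P> \<Longrightarrow> three_graph P"
    and free: "\<And>P. P \<in> \<P> \<Longrightarrow> triangle_free_intersecting (edges P)"
    and max: "\<And>H. three_graph H \<Longrightarrow> card (verts H) = n \<Longrightarrow> triangle_free_intersecting (edges H)
      \<Longrightarrow> \<exists>P\<in>\<P>. contains_copy P H"
  shows "admissible 1 n {M2, C3} = covered n \<P> {}"
proof -
  have "free_of {M2, C3} H" if "three_graph H" "P \<in> \<P>" "contains_copy P H" for H P
  proof -
    have "free_of {M2, C3} P" using free_of_iff tg free that(2) by blast
    then show ?thesis
      using contains_copy_trans[OF _ that(1) _ that(3)] three_graph_M2 three_graph_C3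
      unfolding free_of_def by blast
  qed
  then show ?thesis
    unfolding admissible_1 covered_def using max free_of_iff by blast
qed

text \<open>On at most five vertices even the complete 3-graph is free.\<close>

lemma admissible_1_complete_graph:
  assumes "n \<le> 5"
  shows "admissible 1 n {M2, C3} = covered n {complete_graph n} {}"
proof (rule admissible_1_covered)
  fix P assume "P \<in> {complete_graph n}"
  then have P: "P = complete_graph n" by simp
  show "three_graph P" unfolding P by (rule three_graph_complete_graph)
  show "triangle_free_intersecting (edges P)"
    unfolding P using assms
    by (intro triangle_free_intersecting_five[of "{..<n}"]) (auto simp: complete_graph_def triples_def)
next
  fix H :: hgraph assume "three_graph H" "card (verts H) = n"
  then show "\<exists>P\<in>{complete_graph n}. contains_copy P H"
    using contains_copy_complete_graph[of H] by simp
qed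

lemma admissible_1_extremal:
  assumes "n \<ge> 6"
  shows "admissible 1 n {M2, C3} =
    covered n {star n, add_isolated (complete_graph 5) (n - 5), H0 n} {}"
proof (rule admissible_1_covered)
  fix P assume P: "P \<in> {star n, add_isolated (complete_graph 5) (n - 5), H0 n}"
  show "three_graph P"
    using P assms antichain_extremal unfolding antichain_def by blast
  have "triangle_free_intersecting (edges (star n))"
    by (rule triangle_free_intersecting_star[of _ 0]) (simp add: star_def)
  then show "triangle_free_intersecting (edges P)"
    using P triangle_free_intersecting_add_isolated triangle_free_intersecting_H0 by blast
qed (use triangle_free_intersecting_contained assms in blast)

lemma hierarchy_small:
  assumes "n \<le> 5"
  shows "turan_ex 1 n {M2, C3} = Some (n choose 3)"
    "turan_Ex 1 n {M2, C3} = {iso_type (complete_graph n)}"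
    "s \<ge> 2 \<Longrightarrow> turan_ex s n {M2, C3} = None"
proof -
  let ?P = "{complete_graph n}"
  have anti: "antichain n ?P"
    using three_graph_complete_graph by (simp add: antichain_def complete_graph_def)
  have adm: "admissible 1 n {M2, C3} = covered n ?P {}"
    using assms by (rule admissible_1_complete_graph)
  have max: "max_edge (?P - {}) = ?P" by (simp add: max_edge_singleton)
  have num: "num_edges (complete_graph n) = n choose 3"
    by (simp add: complete_graph_def card_triples)
  show "turan_ex 1 n {M2, C3} = Some (n choose 3)"
    using turan_ex_covered[OF anti _ _ adm, of "complete_graph n"] unfolding max num by simp
  show "turan_Ex 1 n {M2, C3} = {iso_type (complete_graph n)}"
    using turan_Ex_covered[OF anti _ _ adm] unfolding max by simp
  have "admissible (Suc 1) n {M2, C3} = covered n ?P ?P"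
    using admissible_Suc_covered[OF anti _ _ adm] unfolding max by simp
  from turan_ex_None[OF _ _ _ this] anti show "turan_ex s n {M2, C3} = None" if "s \<ge> 2"
    using that by simp
qed

context
  fixes n :: nat and S K B :: hgraph
  assumes n: "n \<ge> 6"
  defines "S \<equiv> star n" and "K \<equiv> add_isolated (complete_graph 5) (n - 5)" and "B \<equiv> H0 n"
begin

lemma anti: "antichain n {S, K, B}"
  unfolding S_def K_def B_def using n by (rule antichain_extremal)

lemma admissible_1_SKB: "admissible 1 n {M2, C3} = covered n {S, K, B} {}"
  unfolding S_def K_def B_def using n by (rule admissible_1_extremal)

lemma num_edges_extremal:
  "num_edges S = (n - 1) choose 2" "num_edges K = 10" "num_edges B = n"
  using n by (simp_all add: S_def K_def B_def num_edges_star num_edges_add_isolated num_edges_H0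
      eval_nat_numeral)

lemma extremal_distinct: "S \<noteq> K" "S \<noteq> B" "K \<noteq> B"
proof -
  have "contains_copy S S" "contains_copy B B"
    using contains_copy_refl anti unfolding antichain_def by blast+
  then show "S \<noteq> K" "S \<noteq> B" "K \<noteq> B"
    using not_contains_star_add_isolated[OF n] not_contains_star_H0[OF n] not_contains_H0_add_isolated[OF n]
    unfolding S_def K_def B_def by metis+
qed

lemma hierarchy_six:
  assumes n6: "n = 6"
  shows "turan_ex 1 n {M2, C3} = Some 10"
    "turan_Ex 1 n {M2, C3} = {iso_type S, iso_type K}"
    "turan_ex 2 n {M2, C3} = Some 6"
    "turan_Ex 2 n {M2, C3} = {iso_type B}"
    "s \<ge> 3 \<Longrightarrow> turan_ex s n {M2, C3} = None"
proof -
  have num: "num_edges S = 10" "num_edges K = 10" "num_edges B = 6"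
    using num_edges_extremal n6 by (simp_all add: eval_nat_numeral)
  \<comment> \<open>The star and \<open>K\<^sub>5\<close> tie here, since
    \<open>5 choose 2 = 5 choose 3\<close>; they leave together.\<close>
  have max1: "max_edge ({S, K, B} - {}) = {S, K}"
    by (rule max_edgeI[of _ _ 10]) (use num in auto)
  show "turan_ex 1 n {M2, C3} = Some 10"
    using turan_ex_covered[OF anti _ _ admissible_1_SKB, of K] unfolding max1 num by simp
  show "turan_Ex 1 n {M2, C3} = {iso_type S, iso_type K}"
    using turan_Ex_covered[OF anti _ _ admissible_1_SKB] unfolding max1 by simp
  have adm2: "admissible 2 n {M2, C3} = covered n {S, K, B} {S, K}"
    using admissible_Suc_covered[OF anti _ _ admissible_1_SKB] unfolding max1
    by (simp add: numeral_2_eq_2)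
  have "{S, K, B} - {S, K} = {B}" using extremal_distinct by blast
  then have max2: "max_edge ({S, K, B} - {S, K}) = {B}" by (simp add: max_edge_singleton)
  show "turan_ex 2 n {M2, C3} = Some 6"
    using turan_ex_covered[OF anti _ _ adm2, of B] unfolding max2 num by simp
  show "turan_Ex 2 n {M2, C3} = {iso_type B}"
    using turan_Ex_covered[OF anti _ _ adm2] unfolding max2 by simp
  have adm3: "admissible 3 n {M2, C3} = covered n {S, K, B} {S, K, B}"
    using admissible_Suc_covered[OF anti _ _ adm2] unfolding max2
    by (simp add: numeral_3_eq_3 numeral_2_eq_2 insert_commute)
  show "turan_ex s n {M2, C3} = None" if "s \<ge> 3"
    using turan_ex_None[OF anti _ _ adm3] that by simp
qed

context
  assumes n7: "n \<ge> 7"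
begin

lemma max_edge_1: "max_edge ({S, K, B} - {}) = {S}"
proof (rule max_edgeI[of _ _ "(n - 1) choose 2"])
  have "n < (n - 1) choose 2" using star_beats_H0[OF n] .
  \<comment> \<open>\<open>6 choose 2 = 15\<close> exceeds the 10 edges of \<open>K\<close>, so from
    \<open>n = 7\<close> on the star is ahead alone.\<close>
  moreover have "(6::nat) choose 2 \<le> (n - 1) choose 2" using n7 by (intro binomial_right_mono) simp
  then have "10 < (n - 1) choose 2" by (simp add: eval_nat_numeral)
  ultimately show "num_edges P < (n - 1) choose 2" if "P \<in> {S, K, B} - {} - {S}" for P
    using that num_edges_extremal by auto
qed (use num_edges_extremal in auto)

lemma hierarchy_first:
  "turan_ex 1 n {M2, C3} = Some ((n - 1) choose 2)"
  "turan_Ex 1 n {M2, C3} = {iso_type S}"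
  using turan_ex_covered[OF anti _ _ admissible_1_SKB, of S]
    turan_Ex_covered[OF anti _ _ admissible_1_SKB]
  unfolding max_edge_1 num_edges_extremal by simp_all

lemma admissible_2_SKB: "admissible 2 n {M2, C3} = covered n {S, K, B} {S}"
  using admissible_Suc_covered[OF anti _ _ admissible_1_SKB] unfolding max_edge_1
  by (simp add: numeral_2_eq_2)

lemma Diff_S: "{S, K, B} - {S} = {K, B}"
  using extremal_distinct by blast

lemma hierarchy_ten:
  assumes "n = 10"
  shows "turan_Ex 2 n {M2, C3} = {iso_type K, iso_type B}"
    "s \<ge> 3 \<Longrightarrow> turan_ex s n {M2, C3} = None"
proof -
  \<comment> \<open>Both have ten edges and are removed in one step, so the hierarchy is one level
    shorter than for other \<open>n \<ge> 7\<close>.\<close>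
  have max2: "max_edge ({S, K, B} - {S}) = {K, B}"
    unfolding Diff_S by (rule max_edgeI[of _ _ 10]) (use num_edges_extremal assms in auto)
  show "turan_Ex 2 n {M2, C3} = {iso_type K, iso_type B}"
    using turan_Ex_covered[OF anti _ _ admissible_2_SKB] unfolding max2 by simp
  have adm3: "admissible 3 n {M2, C3} = covered n {S, K, B} {S, K, B}"
    using admissible_Suc_covered[OF anti _ _ admissible_2_SKB] unfolding max2
    by (simp add: numeral_3_eq_3 numeral_2_eq_2 insert_commute)
  show "turan_ex s n {M2, C3} = None" if "s \<ge> 3"
    using turan_ex_None[OF anti _ _ adm3] that by simp
qed

text \<open>\<open>P\<close> and \<open>Q\<close> stand for \<open>K\<close> and \<open>B\<close> in
  decreasing order of size, so one argument serves both \<open>n < 10\<close> and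
  \<open>n > 10\<close>.\<close>

lemma hierarchy_two_steps:
  assumes PQ: "{P, Q} = {K, B}" "num_edges Q < num_edges P"
  shows "turan_ex 2 n {M2, C3} = Some (num_edges P)"
    "turan_ex 3 n {M2, C3} = Some (num_edges Q)"
    "turan_Ex 2 n {M2, C3} \<union> turan_Ex 3 n {M2, C3} = {iso_type K, iso_type B}"
    "s \<ge> 4 \<Longrightarrow> turan_ex s n {M2, C3} = None"
proof -
  have eq: "{S, K, B} = {S, P, Q}" using PQ(1) by simp
  have ne: "P \<noteq> Q" "P \<noteq> S" "Q \<noteq> S" using PQ extremal_distinct by auto
  note anti = anti[unfolded eq] and adm2 = admissible_2_SKB[unfolded eq]
  have max2: "max_edge ({S, P, Q} - {S}) = {P}"
    by (rule max_edgeI[of _ _ "num_edges P"]) (use PQ(2) ne in auto)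
  have adm3: "admissible 3 n {M2, C3} = covered n {S, P, Q} {S, P}"
    using admissible_Suc_covered[OF anti _ _ adm2] unfolding max2
    by (simp add: numeral_3_eq_3 numeral_2_eq_2 insert_commute)
  have "{S, P, Q} - {S, P} = {Q}" using ne by blast
  then have max3: "max_edge ({S, P, Q} - {S, P}) = {Q}" by (simp add: max_edge_singleton)
  have adm4: "admissible 4 n {M2, C3} = covered n {S, P, Q} {S, P, Q}"
    using admissible_Suc_covered[OF anti _ _ adm3] unfolding max3
    by (simp add: eval_nat_numeral insert_commute)
  show "turan_ex 2 n {M2, C3} = Some (num_edges P)"
    using turan_ex_covered[OF anti _ _ adm2, of P] unfolding max2 by simp
  show "turan_ex 3 n {M2, C3} = Some (num_edges Q)"
    using turan_ex_covered[OF anti _ _ adm3, of Q] unfolding max3 by simp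
  have "turan_Ex 2 n {M2, C3} = iso_type ` {P}"
    using turan_Ex_covered[OF anti _ _ adm2] unfolding max2 by simp
  moreover have "turan_Ex 3 n {M2, C3} = iso_type ` {Q}"
    using turan_Ex_covered[OF anti _ _ adm3] unfolding max3 by simp
  moreover have "iso_type ` {P} \<union> iso_type ` {Q} = iso_type ` {K, B}"
    unfolding PQ(1)[symmetric] by blast
  ultimately show "turan_Ex 2 n {M2, C3} \<union> turan_Ex 3 n {M2, C3} = {iso_type K, iso_type B}"
    by simp
  show "turan_ex s n {M2, C3} = None" if "s \<ge> 4"
    using turan_ex_None[OF anti _ _ adm4] that by simp
qed

lemma hierarchy_large:
  assumes "n \<noteq> 10"
  shows "turan_ex 2 n {M2, C3} = Some (max 10 n)"
    "turan_ex 3 n {M2, C3} = Some (min 10 n)"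
    "turan_Ex 2 n {M2, C3} \<union> turan_Ex 3 n {M2, C3} = {iso_type K, iso_type B}"
    "s \<ge> 4 \<Longrightarrow> turan_ex s n {M2, C3} = None"
proof -
  consider "n < 10" | "n > 10" using assms by linarith
  then have "turan_ex 2 n {M2, C3} = Some (max 10 n) \<and> turan_ex 3 n {M2, C3} = Some (min 10 n) \<and>
    turan_Ex 2 n {M2, C3} \<union> turan_Ex 3 n {M2, C3} = {iso_type K, iso_type B} \<and>
    (s \<ge> 4 \<longrightarrow> turan_ex s n {M2, C3} = None)"
  proof cases
    case 1
    then show ?thesis
      using hierarchy_two_steps[of K B] num_edges_extremal by (simp add: max_def min_def)
  next
    case 2
    then show ?thesis
      using hierarchy_two_steps[of B K] num_edges_extremal by (simp add: max_def min_def insert_commute)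
  qed
  then show "turan_ex 2 n {M2, C3} = Some (max 10 n)"
    "turan_ex 3 n {M2, C3} = Some (min 10 n)"
    "turan_Ex 2 n {M2, C3} \<union> turan_Ex 3 n {M2, C3} = {iso_type K, iso_type B}"
    "s \<ge> 4 \<Longrightarrow> turan_ex s n {M2, C3} = None"
    by blast+
qed

end

end

theorem corollary1:
  fixes n :: nat
  assumes "n \<ge> 1"
  shows
    "(n \<le> 5 \<longrightarrow>
        turan_ex 1 n {M2, C3} = Some (n choose 3) \<and>
        turan_Ex 1 n {M2, C3} = {iso_type (complete_graph n)} \<and>
        (\<forall>s\<ge>2. turan_ex s n {M2, C3} = None)) \<and>
     (n = 6 \<longrightarrow>
        turan_ex 1 6 {M2, C3} = Some 10 \<and>
        turan_Ex 1 6 {M2, C3} = {iso_type (star 6), iso_type (add_isolated (complete_graph 5) 1)} \<and>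
        turan_ex 2 6 {M2, C3} = Some 6 \<and>
        turan_Ex 2 6 {M2, C3} = {iso_type (H0 6)} \<and>
        (\<forall>s\<ge>3. turan_ex s 6 {M2, C3} = None)) \<and>
     (n \<ge> 7 \<longrightarrow>
        turan_ex 1 n {M2, C3} = Some ((n - 1) choose 2) \<and>
        turan_Ex 1 n {M2, C3} = {iso_type (star n)}) \<and>
     (n = 10 \<longrightarrow>
        turan_Ex 2 10 {M2, C3} = {iso_type (add_isolated (complete_graph 5) 5), iso_type (H0 10)} \<and>
        (\<forall>s\<ge>3. turan_ex s 10 {M2, C3} = None)) \<and>
     (n \<ge> 7 \<and> n \<noteq> 10 \<longrightarrow>
        turan_ex 2 n {M2, C3} = Some (max 10 n) \<and>
        turan_ex 3 n {M2, C3} = Some (min 10 n) \<and>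
        turan_Ex 2 n {M2, C3} \<union> turan_Ex 3 n {M2, C3} =
          {iso_type (add_isolated (complete_graph 5) (n - 5)), iso_type (H0 n)} \<and>
        (\<forall>s\<ge>4. turan_ex s n {M2, C3} = None))"
proof (intro conjI impI)
  show "turan_ex 1 n {M2, C3} = Some (n choose 3)"
    "turan_Ex 1 n {M2, C3} = {iso_type (complete_graph n)}"
    "\<forall>s\<ge>2. turan_ex s n {M2, C3} = None" if "n \<le> 5"
    using hierarchy_small[OF that] by blast+
  show "turan_ex 1 6 {M2, C3} = Some 10"
    "turan_Ex 1 6 {M2, C3} = {iso_type (star 6), iso_type (add_isolated (complete_graph 5) 1)}"
    "turan_ex 2 6 {M2, C3} = Some 6" "turan_Ex 2 6 {M2, C3} = {iso_type (H0 6)}"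
    "\<forall>s\<ge>3. turan_ex s 6 {M2, C3} = None"
    using hierarchy_six[of 6] by simp_all
  show "turan_ex 1 n {M2, C3} = Some ((n - 1) choose 2)"
    "turan_Ex 1 n {M2, C3} = {iso_type (star n)}" if "n \<ge> 7"
    using hierarchy_first[of n] that by simp_all
  show "turan_Ex 2 10 {M2, C3} = {iso_type (add_isolated (complete_graph 5) 5), iso_type (H0 10)}"
    "\<forall>s\<ge>3. turan_ex s 10 {M2, C3} = None"
    using hierarchy_ten[of 10] by simp_all
  show "turan_ex 2 n {M2, C3} = Some (max 10 n)"
    "turan_ex 3 n {M2, C3} = Some (min 10 n)"
    "turan_Ex 2 n {M2, C3} \<union> turan_Ex 3 n {M2, C3} =
      {iso_type (add_isolated (complete_graph 5) (n - 5)), iso_type (H0 n)}"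
    "\<forall>s\<ge>4. turan_ex s n {M2, C3} = None" if "n \<ge> 7 \<and> n \<noteq> 10"
    using hierarchy_large[of n] that by simp_all
qed

end
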